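(* Let $\mathscr{C}$ be a closed oligomorphic core clone (on an at most countable domain) which has a pseudo-Taylor term. Then $\mathscr{C}$ satisfies $pL^2_4$.
   Context: A function clone $\mathscr{C}$ on a set $C$ is a set of operations on $C$ of finite arity $\ge 1$ containing all projections and closed under composition. $\operatorname{Gr}(\mathscr{C})$ is the group of all unary bijections in $\mathscr{C}$ whose inverse is also in $\mathscr{C}$. $\mathscr{C}$ is oligomorphic if $\operatorname{Gr}(\mathscr{C})$ has finitely many orbits in its componentwise action on $C^k$ for every $k\ge 1$. $\mathscr{C}$ is closed if it is topologically closed in the set of all finitary operations on $C$ with the topology of pointwise convergence ($C$ discrete). $\mathscr{C}$ is a core if $\operatorname{Gr}(\mathscr{C})$ is dense (pointwise topology) in the unary functions of $\mathscr{C}$. A pseudo-Taylor term of $\mathscr{C}$ is, for some $n\ge 1$, an $n$-ary $t\in\mathscr{C}$ for which there are unary $u_1,v_1,\dots,u_n,v_n\in\mathscr{C}$ such that, for some choice of $x_{i,j},y_{i,j}\in\{x,y\}$ ($1\le i,j\le n$) with $x_{i,i}=x$ and $y_{i,i}=y$, the equations $u_i\circ t(x_{i,1},\ldots,x_{i,n})= v_i\circ t(y_{i,1},\ldots,y_{i,n})$, $1\le i\le n$, hold for all values of the variables $x,y$ in $C$. $pL^2_4$ is the pseudo-loop condition $u_1\circ f(r_{1,1},\ldots,r_{1,12})\approx u_2\circ f(r_{2,1},\ldots,r_{2,12})$, where $f$ is a $12$-ary and $u_1,u_2$ are unary function symbols, and $(r_{1,i},r_{2,i})$, $1\le i\le 12$,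 enumerates all pairs of distinct elements of $\{1,2,3,4\}$, regarded as variables. $\mathscr{C}$ satisfies it if $f,u_1,u_2$ can be assigned functions of $\mathscr{C}$ such that the equation holds for all values of the variables in $C$. *)

theory Defs
  imports "HOL-Analysis.Analysis" "HOL-Algebra.Group_Action"
begin

definition tuples :: "nat \<Rightarrow> 'a list set" where
  "tuples n = {xs. length xs = n}"

text \<open>
  The domain of the clone is the whole type \<^typ>\<open>'a\<close>. An \<open>n\<close>-ary operation is a function on
  lists of length \<open>n\<close>, made extensional (\<open>undefined\<close> off \<open>tuples n\<close>) so that it is determined by
  its values on \<open>n\<close>-tuples. A set of finitary operations is a set of pairs (arity, operation);
  the tag is needed because on a one-element domain operations of different arities coincide as
  extensional functions.
\<close>

type_synonym 'a operations = "(nat \<times> ('a list \<Rightarrow> 'a)) set"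

definition finitary_operations :: "'a operations" where
  "finitary_operations = Sigma {1..} (\<lambda>n. tuples n \<rightarrow>\<^sub>E UNIV)"

definition nary :: "'a operations \<Rightarrow> nat \<Rightarrow> ('a list \<Rightarrow> 'a) set" where
  "nary \<C> n = {f. (n, f) \<in> \<C>}"

definition projection :: "nat \<Rightarrow> nat \<Rightarrow> 'a list \<Rightarrow> 'a" where
  "projection n i = (\<lambda>xs\<in>tuples n. xs ! i)"

definition composition :: "nat \<Rightarrow> ('a list \<Rightarrow> 'a) \<Rightarrow> ('a list \<Rightarrow> 'a) list \<Rightarrow> 'a list \<Rightarrow> 'a" where
  "composition m f gs = (\<lambda>xs\<in>tuples m. f (map (\<lambda>g. g xs) gs))"

definition clone :: "'a operations \<Rightarrow> bool" where
  "clone \<C> \<longleftrightarrow>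
     \<C> \<subseteq> finitary_operations \<and>
     (\<forall>n i. i < n \<longrightarrow> projection n i \<in> nary \<C> n) \<and>
     (\<forall>m n f gs. f \<in> nary \<C> n \<and> length gs = n \<and> set gs \<subseteq> nary \<C> m
        \<longrightarrow> composition m f gs \<in> nary \<C> m)"

definition unary_op :: "('a \<Rightarrow> 'a) \<Rightarrow> 'a list \<Rightarrow> 'a" where
  "unary_op g = (\<lambda>xs\<in>tuples 1. g (hd xs))"

definition Gr :: "'a operations \<Rightarrow> ('a \<Rightarrow> 'a) monoid" where
  "Gr \<C> = \<lparr>carrier = {g. bij g \<and> unary_op g \<in> nary \<C> 1 \<and> unary_op (inv_into UNIV g) \<in> nary \<C> 1},
           monoid.mult = (\<circ>), one = id\<rparr>"

definition oligomorphic :: "'a operations \<Rightarrow> bool" where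
  "oligomorphic \<C> \<longleftrightarrow> (\<forall>k\<ge>1. finite (orbits (Gr \<C>) (tuples k) map))"

definition pointwise_topology :: "nat \<Rightarrow> ('a list \<Rightarrow> 'a) topology" where
  "pointwise_topology n = product_topology (\<lambda>_. discrete_topology UNIV) (tuples n)"

definition operations_topology :: "(nat \<times> ('a list \<Rightarrow> 'a)) topology" where
  "operations_topology = sum_topology pointwise_topology {1..}"

definition closed_operations :: "'a operations \<Rightarrow> bool" where
  "closed_operations \<C> \<longleftrightarrow> closedin operations_topology \<C>"

definition core :: "'a operations \<Rightarrow> bool" where
  "core \<C> \<longleftrightarrow>
     subtopology (pointwise_topology 1) (nary \<C> 1) closure_of (unary_op ` carrier (Gr \<C>)) = nary \<C> 1"

datatype variable = X | Y

text \<open>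
  Argument positions are \<open>0, \<dots>, n - 1\<close>. The functions \<open>a\<close> and \<open>b\<close> are the matrices of
  variables on the left and on the right, and \<open>\<sigma>\<close> assigns values to the two variables.
\<close>

definition pseudo_taylor_term :: "'a operations \<Rightarrow> nat \<Rightarrow> ('a list \<Rightarrow> 'a) \<Rightarrow> bool" where
  "pseudo_taylor_term \<C> n t \<longleftrightarrow>
     n \<ge> 1 \<and> t \<in> nary \<C> n \<and>
     (\<exists>(u :: nat \<Rightarrow> 'a list \<Rightarrow> 'a) v (a :: nat \<Rightarrow> nat \<Rightarrow> variable) b.
        (\<forall>i<n. u i \<in> nary \<C> 1 \<and> v i \<in> nary \<C> 1 \<and> a i i = X \<and> b i i = Y) \<and>
        (\<forall>i<n. \<forall>\<sigma> :: variable \<Rightarrow> 'a.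
           u i [t (map (\<lambda>j. \<sigma> (a i j)) [0..<n])] = v i [t (map (\<lambda>j. \<sigma> (b i j)) [0..<n])]))"

text \<open>The pairs \<open>(r\<^sub>1\<^sub>,\<^sub>i, r\<^sub>2\<^sub>,\<^sub>i)\<close>, in lexicographic order.\<close>

definition distinct_pairs_4 :: "(nat \<times> nat) list" where
  "distinct_pairs_4 =
     [(1,2), (1,3), (1,4), (2,1), (2,3), (2,4), (3,1), (3,2), (3,4), (4,1), (4,2), (4,3)]"

text \<open>A valuation \<open>\<sigma>\<close> of the variables \<open>1, \<dots>, 4\<close> is a function on all of \<^typ>\<open>nat\<close>; its other
  values are irrelevant.\<close>

definition satisfies_pL24 :: "'a operations \<Rightarrow> bool" where
  "satisfies_pL24 \<C> \<longleftrightarrow>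
     (\<exists>f u1 u2. f \<in> nary \<C> 12 \<and> u1 \<in> nary \<C> 1 \<and> u2 \<in> nary \<C> 1 \<and>
        (\<forall>\<sigma> :: nat \<Rightarrow> 'a.
           u1 [f (map (\<lambda>r. \<sigma> (fst r)) distinct_pairs_4)] =
           u2 [f (map (\<lambda>r. \<sigma> (snd r)) distinct_pairs_4)]))"

lemma distinct_pairs_4_enumerates:
  "distinct distinct_pairs_4" "length distinct_pairs_4 = 12"
  "set distinct_pairs_4 = {(r, s). r \<in> {1..4} \<and> s \<in> {1..4} \<and> r \<noteq> s}"
proof -
  have "{1..4} = {1, 2, 3, 4 :: nat}" by auto
  then show "set distinct_pairs_4 = {(r, s). r \<in> {1..4} \<and> s \<in> {1..4} \<and> r \<noteq> s}"
    unfolding distinct_pairs_4_def by auto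
qed (simp_all add: distinct_pairs_4_def)

lemma topspace_operations_topology: "topspace operations_topology = finitary_operations"
  by (simp add: operations_topology_def finitary_operations_def pointwise_topology_def o_def)

lemma composition_unary_op:
  "composition 1 (unary_op g) [unary_op h] = unary_op (g \<circ> h)"
  by (auto simp: composition_def unary_op_def tuples_def fun_eq_iff)

lemma unary_op_id: "unary_op id = projection 1 0"
proof
  fix xs :: "'a list"
  show "unary_op id xs = projection 1 0 xs"
    by (cases xs) (auto simp: unary_op_def projection_def tuples_def)
qed

lemma group_Gr:
  assumes "clone \<C>"
  shows "group (Gr \<C>)"
proof -
  have comp: "unary_op (g \<circ> h) \<in> nary \<C> 1"
    if "unary_op g \<in> nary \<C> 1" "unary_op h \<in> nary \<C> 1" for g h
  proof -
    have *: "composition m f gs \<in> nary \<C> m"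
      if "f \<in> nary \<C> n" "length gs = n" "set gs \<subseteq> nary \<C> m" for m n f gs
      using assms that unfolding clone_def by blast
    have "composition 1 (unary_op g) [unary_op h] \<in> nary \<C> 1"
      using that by (intro *[of _ 1]) simp_all
    then show ?thesis by (simp only: composition_unary_op)
  qed
  have id: "unary_op id \<in> nary \<C> 1"
    using assms unfolding clone_def unary_op_id by simp
  show ?thesis
  proof (rule groupI)
    fix g h assume "g \<in> carrier (Gr \<C>)" "h \<in> carrier (Gr \<C>)"
    then show "g \<otimes>\<^bsub>Gr \<C>\<^esub> h \<in> carrier (Gr \<C>)"
      by (simp add: Gr_def bij_comp o_inv_distrib comp[unfolded One_nat_def])
  next
    fix g assume g: "g \<in> carrier (Gr \<C>)"
    then have "bij g" by (simp add: Gr_def)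
    with g show "\<exists>h\<in>carrier (Gr \<C>). h \<otimes>\<^bsub>Gr \<C>\<^esub> g = \<one>\<^bsub>Gr \<C>\<^esub>"
      by (intro bexI[of _ "inv_into UNIV g"])
        (auto simp: Gr_def bij_imp_bij_inv inv_inv_eq bij_is_inj)
  qed (use id in \<open>auto simp: Gr_def\<close>)
qed

end

theory Submission
  imports Defs
begin

text \<open>
  By compactness it suffices to show that on every finite power \<open>A\<close> of the domain each
  symmetric invariant relation \<open>R\<close> containing a triangle has an edge inside an orbit. In a
  counterexample \<open>R\<close> whose triangles meet as few orbits as possible, every invariant set missing
  one of these orbits is triangle-free. Hence a maximal invariant set \<open>U\<close> that contains an orbit
  and none of its neighbours has no inner edge, and contains \<open>x\<close> whenever \<open>x, y, z\<close> is a triangle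
  with \<open>y\<close> and \<open>z\<close> adjacent to \<open>U\<close>. For every \<open>n\<close>-ary operation applied to the vertices of a
  fixed triangle, the arguments in \<open>K\<^sub>3\<^sup>n\<close> mapped into \<open>U\<close>, if there are any,
  therefore form a subcube given by a nonempty set of fixed coordinates.

  Choose \<open>U\<close> and an operation \<open>\<phi>\<close> for which the number of fixed coordinates is maximal.
  Composing the pseudo-Taylor term \<open>\<tau>\<close> with \<open>\<phi>\<close> in every argument cannot increase it, so a fixed
  coordinate of \<open>\<phi>\<close> is fixed in only one block \<open>i\<close> of the composition. The \<open>i\<close>-th pseudo-Taylor
  equation, applied to two words that differ in this coordinate only, leads from \<open>U\<close> out of \<open>U\<close>
  within an orbit.
\<close>

section \<open>Clones with finitely many orbits\<close>

definition triangle_vertices :: "'b rel \<Rightarrow> 'b set" where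
  "triangle_vertices R = {x. \<exists>y z. (x, y) \<in> R \<and> (y, z) \<in> R \<and> (z, x) \<in> R}"

text \<open>
  Operations take infinite sequences of arguments, which avoids arities in compositions. They
  depend on finitely many arguments only up to \<open>E\<close>, because on powers of the domain the entries
  that do not matter are left unconstrained.
\<close>

locale finite_orbit_clone =
  fixes T :: "((nat \<Rightarrow> 'b) \<Rightarrow> 'b) set" and E :: "'b rel"
  assumes equiv_E: "equiv UNIV E"
    and finite_orbits: "finite (UNIV // E)"
    and proj_in: "(\<lambda>x. x i) \<in> T"
    and comp_in: "\<phi> \<in> T \<Longrightarrow> (\<And>i. \<psi> i \<in> T) \<Longrightarrow> (\<lambda>x. \<phi> (\<lambda>i. \<psi> i x)) \<in> T"
    and finitary: "\<phi> \<in> T \<Longrightarrow> \<exists>n. \<forall>x y. (\<forall>i<n. x i = y i) \<longrightarrow> (\<phi> x, \<phi> y) \<in> E"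
    and orbit_op: "(x, y) \<in> E \<Longrightarrow> \<exists>\<phi>\<in>T. \<phi> (\<lambda>_. x) = y"
    and idempotent_op: "\<phi> \<in> T \<Longrightarrow> finite B \<Longrightarrow>
      \<exists>\<psi>\<in>T. (\<forall>x\<in>B. \<psi> (\<lambda>_. x) = x) \<and> (\<forall>x. (\<phi> x, \<psi> x) \<in> E)"
begin

lemma E_refl: "(x, x) \<in> E"
  using equiv_E by (simp add: equiv_def refl_on_def)

lemma E_sym: "(x, y) \<in> E \<Longrightarrow> (y, x) \<in> E"
  using equiv_E by (meson equiv_def symD)

lemma E_trans: "(x, y) \<in> E \<Longrightarrow> (y, z) \<in> E \<Longrightarrow> (x, z) \<in> E"
  using equiv_E by (meson equiv_def transD)

text \<open>The core property enters here: an operation that is idempotent at \<open>x\<close> and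
  agrees with \<open>\<phi>\<close> up to \<open>E\<close> sends the constant sequence to
  \<open>x\<close> itself.\<close>

lemma diagonal_E: "\<phi> \<in> T \<Longrightarrow> (\<phi> (\<lambda>_. x), x) \<in> E"
  using idempotent_op[of \<phi> "{x}"] by (metis finite.emptyI finite_insert singletonI)

section \<open>Invariant sets and relations\<close>

definition invariant :: "'b set \<Rightarrow> bool" where
  "invariant U \<longleftrightarrow> (\<forall>\<phi>\<in>T. \<forall>x. (\<forall>i. x i \<in> U) \<longrightarrow> \<phi> x \<in> U)"

definition invariant_rel :: "'b rel \<Rightarrow> bool" where
  "invariant_rel R \<longleftrightarrow>
     (\<forall>\<phi>\<in>T. \<forall>x y. (\<forall>i. (x i, y i) \<in> R) \<longrightarrow> (\<phi> x, \<phi> y) \<in> R)"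

definition orbits_meeting :: "'b set \<Rightarrow> 'b set set" where
  "orbits_meeting U = (\<lambda>x. E `` {x}) ` U"

lemma finite_orbits_meeting: "finite (orbits_meeting U)"
proof (rule finite_subset[OF _ finite_orbits])
  show "orbits_meeting U \<subseteq> UNIV // E"
    by (auto simp: orbits_meeting_def quotient_def)
qed

lemma invariant_apply: "\<lbrakk>invariant U; \<phi> \<in> T; \<And>i. x i \<in> U\<rbrakk> \<Longrightarrow> \<phi> x \<in> U"
  by (simp add: invariant_def)

lemma invariant_rel_apply:
  "\<lbrakk>invariant_rel R; \<phi> \<in> T; \<And>i. (x i, y i) \<in> R\<rbrakk> \<Longrightarrow> (\<phi> x, \<phi> y) \<in> R"
  by (simp add: invariant_rel_def)

lemma invariant_E: "invariant U \<Longrightarrow> x \<in> U \<Longrightarrow> (x, y) \<in> E \<Longrightarrow> y \<in> U"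
  using orbit_op[of x y] invariant_apply[of U _ "\<lambda>_. x"] by metis

lemma invariant_E_iff: "invariant U \<Longrightarrow> (x, y) \<in> E \<Longrightarrow> x \<in> U \<longleftrightarrow> y \<in> U"
  using invariant_E E_sym by blast

text \<open>All arguments are values of operations at the constant sequence of \<open>a\<close>.
  Hence so is the result, and diagonals preserve orbits by \<open>diagonal_E\<close>.\<close>

lemma invariant_orbit: "invariant (E `` {a})"
  unfolding invariant_def
proof (intro ballI allI impI)
  fix \<phi> and x :: "nat \<Rightarrow> 'b" assume \<phi>: "\<phi> \<in> T" and x: "\<forall>i. x i \<in> E `` {a}"
  then have "\<forall>i. \<exists>\<psi>. \<psi> \<in> T \<and> \<psi> (\<lambda>_. a) = x i"
    using orbit_op by (simp add: Bex_def)
  from choice[OF this] obtain \<psi> where \<psi>: "\<And>i. \<psi> i \<in> T" "\<And>i. \<psi> i (\<lambda>_. a) = x i"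
    by auto
  have "(a, (\<lambda>z. \<phi> (\<lambda>i. \<psi> i z)) (\<lambda>_. a)) \<in> E"
    by (rule E_sym, rule diagonal_E, rule comp_in) (use \<phi> \<psi> in auto)
  then show "\<phi> x \<in> E `` {a}" by (simp add: \<psi>)
qed

lemma invariant_Int: "invariant U \<Longrightarrow> invariant W \<Longrightarrow> invariant (U \<inter> W)"
  by (simp add: invariant_def)

text \<open>Here and in the next lemma the set has a primitive positive definition: witnesses are
  chosen for each argument, and \<open>\<phi>\<close> is applied to them as well.\<close>

lemma invariant_Image:
  assumes "invariant_rel R" "invariant U"
  shows "invariant (R `` U)"
  unfolding invariant_def
proof (intro ballI allI impI)
  fix \<phi> and x :: "nat \<Rightarrow> 'b" assume \<phi>: "\<phi> \<in> T" and "\<forall>i. x i \<in> R `` U"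
  then have "\<forall>i. \<exists>u. u \<in> U \<and> (u, x i) \<in> R"
    by (simp add: Image_iff Bex_def)
  from choice[OF this] obtain u where u: "\<And>i. u i \<in> U" "\<And>i. (u i, x i) \<in> R"
    by auto
  have "\<phi> u \<in> U" "(\<phi> u, \<phi> x) \<in> R"
    using assms \<phi> u by (auto intro: invariant_apply invariant_rel_apply)
  then show "\<phi> x \<in> R `` U" by blast
qed

lemma invariant_triangle_vertices_restricted:
  assumes R: "invariant_rel R" and W: "invariant W"
  shows "invariant {x. \<exists>y\<in>W. \<exists>z\<in>W. (x, y) \<in> R \<and> (y, z) \<in> R \<and> (z, x) \<in> R}"
  unfolding invariant_def
proof (intro ballI allI impI)
  fix \<phi> and x :: "nat \<Rightarrow> 'b" assume \<phi>: "\<phi> \<in> T"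
    and "\<forall>i. x i \<in> {x. \<exists>y\<in>W. \<exists>z\<in>W. (x, y) \<in> R \<and> (y, z) \<in> R \<and> (z, x) \<in> R}"
  then have "\<forall>i. \<exists>y z. y \<in> W \<and> z \<in> W \<and> (x i, y) \<in> R \<and> (y, z) \<in> R \<and> (z, x i) \<in> R"
    by blast
  then obtain y z where yz: "\<forall>i. y i \<in> W \<and> z i \<in> W \<and> (x i, y i) \<in> R \<and> (y i, z i) \<in> R \<and> (z i, x i) \<in> R"
    by metis
  then have "\<phi> y \<in> W" "\<phi> z \<in> W" "(\<phi> x, \<phi> y) \<in> R" "(\<phi> y, \<phi> z) \<in> R" "(\<phi> z, \<phi> x) \<in> R"
    using R W \<phi> yz by (simp_all add: invariant_apply invariant_rel_apply)
  then show "\<phi> x \<in> {x. \<exists>y\<in>W. \<exists>z\<in>W. (x, y) \<in> R \<and> (y, z) \<in> R \<and> (z, x) \<in> R}"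
    by blast
qed

lemma invariant_triangle_vertices:
  assumes "invariant_rel R"
  shows "invariant (triangle_vertices R)"
  using invariant_triangle_vertices_restricted[OF assms, of UNIV]
  by (simp add: triangle_vertices_def invariant_def)

lemma invariant_rel_restrict:
  "invariant_rel R \<Longrightarrow> invariant W \<Longrightarrow> invariant_rel (R \<inter> W \<times> W)"
  unfolding invariant_rel_def[of "R \<inter> W \<times> W"]
  by (simp add: invariant_apply invariant_rel_apply)

text \<open>Invariant sets are unions of orbits, of which there are finitely many.\<close>

lemma finite_invariant: "finite {U. invariant U}"
proof (rule finite_subset)
  show "{U. invariant U} \<subseteq> Union ` Pow (UNIV // E)"
  proof
    fix U assume "U \<in> {U. invariant U}"
    then have U: "invariant U" by simp
    have "U = \<Union> (orbits_meeting U)"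
      using invariant_E[OF U] E_refl by (force simp: orbits_meeting_def)
    moreover have "orbits_meeting U \<subseteq> UNIV // E"
      by (auto simp: orbits_meeting_def quotient_def)
    ultimately show "U \<in> Union ` Pow (UNIV // E)" by (metis PowI imageI)
  qed
  show "finite (Union ` Pow (UNIV // E))"
    using finite_orbits by simp
qed

text \<open>
  In \<open>K\<^sub>3\<^sup>n\<close> the nonempty sets with the following property are the subcubes obtained by fixing at
  least one coordinate.
\<close>

definition triangle_closed :: "'b rel \<Rightarrow> 'b set \<Rightarrow> bool" where
  "triangle_closed R U \<longleftrightarrow> invariant U \<and> R \<inter> U \<times> U = {} \<and>
     (\<forall>x y z. (x, y) \<in> R \<and> (y, z) \<in> R \<and> (z, x) \<in> R \<and> y \<in> R `` U \<and> z \<in> R `` U \<longrightarrow> x \<in> U)"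

definition loopless_graph :: "'b rel \<Rightarrow> bool" where
  "loopless_graph R \<longleftrightarrow>
     sym R \<and> invariant_rel R \<and> R \<inter> E = {} \<and> triangle_vertices R \<noteq> {}"

text \<open>Starting from the orbit of \<open>a\<close>, sets that contain none of its neighbours
  are enlarged by \<open>expand\<close>, the closure step in \<open>triangle_closed\<close>.
  Minimality of \<open>R\<close> keeps the enlarged set free of such neighbours, so a maximal good
  set is closed under the step.\<close>

lemma triangle_closed_cover:
  assumes R: "loopless_graph R"
    and least: "\<And>S. loopless_graph S \<Longrightarrow>
      card (orbits_meeting (triangle_vertices R)) \<le> card (orbits_meeting (triangle_vertices S))"
    and a: "a \<in> triangle_vertices R"
  shows "\<exists>U. triangle_closed R U \<and> a \<in> U"
proof -
  have sym: "(x, y) \<in> R \<Longrightarrow> (y, x) \<in> R" for x y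
    using R by (auto simp: loopless_graph_def dest: symD)
  have inv: "invariant_rel R" and noloop: "R \<inter> E = {}"
    using R by (auto simp: loopless_graph_def)
  define orb where "orb = triangle_vertices R \<inter> E `` {a}"
  define good where "good U \<longleftrightarrow> invariant U \<and> orb \<subseteq> U \<and> U \<subseteq> triangle_vertices R \<and> U \<inter> R `` orb = {}" for U
  define expand where "expand U = {x. \<exists>y\<in>R `` U. \<exists>z\<in>R `` U. (x, y) \<in> R \<and> (y, z) \<in> R \<and> (z, x) \<in> R}" for U
  \<comment> \<open>A common element would give a triangle inside \<open>R\<close>
    U\<open>. By symmetry\<close>R \<open>U\<close> misses the orbit of \<open>a\<close>, so
    restricting \<open>R\<close> to it would leave a loopless graph whose triangles meet fewer
    orbits.\<close>
  have next_disjoint: "expand U \<inter> R `` U = {}" if U: "good U" for U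
  proof (rule ccontr)
    assume "expand U \<inter> R `` U \<noteq> {}"
    let ?S = "R \<inter> R `` U \<times> R `` U"
    have "loopless_graph ?S"
      unfolding loopless_graph_def
    proof (intro conjI)
      show "sym ?S" using sym by (auto simp: sym_def)
      show "invariant_rel ?S"
        using U inv by (intro invariant_rel_restrict invariant_Image) (auto simp: good_def)
      show "?S \<inter> E = {}" using noloop by auto
      show "triangle_vertices ?S \<noteq> {}"
        using \<open>expand U \<inter> R `` U \<noteq> {}\<close> unfolding expand_def triangle_vertices_def by blast
    qed
    then have le: "card (orbits_meeting (triangle_vertices R)) \<le> card (orbits_meeting (triangle_vertices ?S))"
      by (rule least)
    have "triangle_vertices ?S \<subseteq> triangle_vertices R \<inter> R `` U"
      by (auto simp: triangle_vertices_def)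
    moreover have "R `` U \<inter> orb = {}"
      using U sym unfolding good_def by blast
    ultimately have "triangle_vertices ?S \<subseteq> triangle_vertices R" "triangle_vertices ?S \<inter> E `` {a} = {}"
      unfolding orb_def by blast+
    then have "E `` {a} \<notin> orbits_meeting (triangle_vertices ?S)"
      using E_refl by (force simp: orbits_meeting_def)
    moreover have "E `` {a} \<in> orbits_meeting (triangle_vertices R)"
      using a by (auto simp: orbits_meeting_def)
    moreover have "orbits_meeting (triangle_vertices ?S) \<subseteq> orbits_meeting (triangle_vertices R)"
      using \<open>triangle_vertices ?S \<subseteq> triangle_vertices R\<close> by (auto simp: orbits_meeting_def)
    ultimately have "card (orbits_meeting (triangle_vertices ?S)) < card (orbits_meeting (triangle_vertices R))"
      by (intro psubset_card_mono finite_orbits_meeting) blast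
    with le show False by simp
  qed
  have next_supset: "U \<subseteq> expand U" if U: "good U" for U
  proof
    fix x assume "x \<in> U"
    with U obtain y z where "(x, y) \<in> R" "(y, z) \<in> R" "(z, x) \<in> R"
      unfolding good_def triangle_vertices_def by blast
    with \<open>x \<in> U\<close> sym show "x \<in> expand U"
      unfolding expand_def by blast
  qed
  have next_good: "good (expand U)" if U: "good U" for U
    unfolding good_def
  proof (intro conjI)
    show "invariant (expand U)"
      unfolding expand_def using U inv
      by (intro invariant_triangle_vertices_restricted invariant_Image) (auto simp: good_def)
    show "orb \<subseteq> expand U" using U next_supset[OF U] by (auto simp: good_def)
    show "expand U \<subseteq> triangle_vertices R" by (auto simp: expand_def triangle_vertices_def)
    have "R `` orb \<subseteq> R `` U" using U by (auto simp: good_def)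
    then show "expand U \<inter> R `` orb = {}" using next_disjoint[OF U] by blast
  qed
  \<comment> \<open>An edge between two elements of one orbit would be a loop modulo
    \<open>E\<close>.\<close>
  have "good orb"
    unfolding good_def
  proof (intro conjI)
    show "invariant orb"
      unfolding orb_def using inv
      by (intro invariant_Int invariant_triangle_vertices invariant_orbit)
    show "orb \<inter> R `` orb = {}"
    proof -
      have "(x, y) \<in> E" if "x \<in> orb" "y \<in> orb" for x y
        using that E_sym E_trans unfolding orb_def by blast
      then show ?thesis using noloop by blast
    qed
  qed (auto simp: orb_def)
  moreover have "finite {U. good U}"
    by (rule finite_subset[OF _ finite_invariant]) (auto simp: good_def)
  ultimately obtain U where U: "good U" and max: "\<And>W. good W \<Longrightarrow> U \<subseteq> W \<Longrightarrow> U = W"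
    using finite_has_maximal[of "{U. good U}"] by (metis (no_types, lifting) empty_iff mem_Collect_eq)
  have next_eq: "expand U = U"
    using max[OF next_good[OF U] next_supset[OF U]] by simp
  have "R \<inter> U \<times> U = {}"
    using next_disjoint[OF U] unfolding next_eq by blast
  moreover have "x \<in> U" if "(x, y) \<in> R" "(y, z) \<in> R" "(z, x) \<in> R" "y \<in> R `` U" "z \<in> R `` U" for x y z
  proof -
    have "x \<in> expand U" using that unfolding expand_def by blast
    then show ?thesis by (simp add: next_eq)
  qed
  ultimately have "triangle_closed R U"
    using U unfolding triangle_closed_def good_def by (intro conjI allI impI) (elim conjE, assumption)+
  moreover have "a \<in> U"
    using U a E_refl unfolding good_def orb_def by blast
  ultimately show ?thesis by blast
qed


end

section \<open>Sets of words with a fixed set of coordinates\<close>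

lemma other_element: "\<exists>u::3. u \<noteq> c"
  by (rule exI[of _ "c + 1"]) simp

text \<open>One coordinate of the closure step in \<open>K_3\<close>: \<open>v\<close> is completed
  to a triangle by a neighbour \<open>y\<close> of \<open>a\<close> and a neighbour \<open>z\<close>
  of \<open>b\<close>. If \<open>a = b\<close>, then \<open>y\<close> and \<open>z\<close> are the
  two other vertices, which forces \<open>v = a\<close>.\<close>

lemma third_vertices:
  fixes a b v :: 3
  assumes "a = b \<longrightarrow> v = a"
  shows "\<exists>y z. y \<noteq> v \<and> y \<noteq> z \<and> z \<noteq> v \<and> y \<noteq> a \<and> z \<noteq> b"
proof -
  have "\<forall>a b v::3. (a = b \<longrightarrow> v = a) \<longrightarrow> \<not> (\<forall>y z. \<not> (y \<noteq> v \<and> y \<noteq> z \<and> z \<noteq> v \<and> y \<noteq> a \<and> z \<noteq> b))"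
    unfolding forall_3 by simp
  with assms show ?thesis by blast
qed

text \<open>For empty \<open>F\<close> this is all of \<open>UNIV\<close>, hence the nonemptiness
  assumptions below; the empty set is not a \<open>subcube\<close>.\<close>

definition fixed_coords :: "(nat \<Rightarrow> 3) set \<Rightarrow> nat set" where
  "fixed_coords F = {l. \<forall>v\<in>F. \<forall>w\<in>F. v l = w l}"

definition subcube :: "(nat \<Rightarrow> 3) set \<Rightarrow> bool" where
  "subcube F \<longleftrightarrow> finite (fixed_coords F) \<and>
     (\<forall>w\<in>F. \<forall>v. (\<forall>l\<in>fixed_coords F. v l = w l) \<longrightarrow> v \<in> F)"

lemma fixed_coordsD: "\<lbrakk>l \<in> fixed_coords F; v \<in> F; w \<in> F\<rbrakk> \<Longrightarrow> v l = w l"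
  by (auto simp: fixed_coords_def)

lemma subcubeD: "\<lbrakk>subcube F; w \<in> F; \<And>l. l \<in> fixed_coords F \<Longrightarrow> v l = w l\<rbrakk> \<Longrightarrow> v \<in> F"
  by (auto simp: subcube_def)

lemma fixed_coords_bounded:
  assumes dep: "\<And>v w. (\<And>l. l < n \<Longrightarrow> v l = w l) \<Longrightarrow> v \<in> F \<Longrightarrow> w \<in> F" and "F \<noteq> {}"
  shows "fixed_coords F \<subseteq> {..<n}"
proof (rule ccontr)
  assume "\<not> fixed_coords F \<subseteq> {..<n}"
  then obtain l where l: "l \<in> fixed_coords F" "l \<ge> n" by force
  obtain w where w: "w \<in> F" using \<open>F \<noteq> {}\<close> by blast
  obtain u where u: "u \<noteq> w l" using other_element by blast
  have "w(l := u) \<in> F" using dep[OF _ w, of "w(l := u)"] l by auto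
  then show False using fixed_coordsD[OF l(1) w] u by fastforce
qed

text \<open>Among the sets of coordinates on which agreement with \<open>w\<close> forces membership
  in \<open>F\<close>, a minimal one contains fixed coordinates only: a coordinate in which some
  \<open>w'\<close> in \<open>F\<close> differs from \<open>w\<close> could be removed by
  \<open>meet\<close>.\<close>

lemma subcubeI:
  assumes dep: "\<And>v w. (\<And>l. l < n \<Longrightarrow> v l = w l) \<Longrightarrow> v \<in> F \<Longrightarrow> w \<in> F" and "F \<noteq> {}"
    and meet: "\<And>w w' v. \<lbrakk>w \<in> F; w' \<in> F; \<And>l. w l = w' l \<Longrightarrow> v l = w l\<rbrakk> \<Longrightarrow> v \<in> F"
  shows "subcube F"
  unfolding subcube_def
proof (intro conjI ballI allI impI)
  show "finite (fixed_coords F)"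
    using fixed_coords_bounded[of n F] assms finite_subset by blast
next
  fix w v assume w: "w \<in> F" and v: "\<forall>l\<in>fixed_coords F. v l = w l"
  define determines where "determines D \<longleftrightarrow> D \<subseteq> {..<n} \<and> (\<forall>v. (\<forall>l\<in>D. v l = w l) \<longrightarrow> v \<in> F)" for D
  have "determines {..<n}"
    unfolding determines_def using dep[OF _ w] by auto
  moreover have "finite {D. determines D}"
    by (rule finite_subset[of _ "Pow {..<n}"]) (auto simp: determines_def)
  ultimately obtain D where D: "determines D" and least: "\<And>D'. determines D' \<Longrightarrow> D' \<subseteq> D \<Longrightarrow> D = D'"
    using finite_has_minimal[of "{D. determines D}"] by blast
  have "D \<subseteq> fixed_coords F"
  proof (rule ccontr)
    assume "\<not> D \<subseteq> fixed_coords F"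
    then obtain l w' where l: "l \<in> D" and w': "w' \<in> F" "w' l \<noteq> w l"
      by (auto simp: fixed_coords_def) metis
    have "determines (D - {l})"
      unfolding determines_def
    proof (intro conjI allI impI)
      show "D - {l} \<subseteq> {..<n}" using D by (auto simp: determines_def)
    next
      fix v assume v: "\<forall>k\<in>D - {l}. v k = w k"
      have "\<forall>k. \<exists>u. u \<noteq> w' k" using other_element by blast
      from choice[OF this] obtain d where d: "\<And>k. d k \<noteq> w' k" by blast
      \<comment> \<open>Outside \<open>D\<close> the word \<open>w''\<close> avoids
        \<open>w'\<close>, so the two agree only inside \<open>D - {l}\<close>.\<close>
      define w'' where "w'' k = (if k \<in> D then w k else d k)" for k
      have "w'' \<in> F" using D by (auto simp: determines_def w''_def)
      then show "v \<in> F"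
      proof (rule meet[OF _ w'(1)])
        fix k assume "w'' k = w' k"
        then have "k \<in> D - {l}" using d[of k] w' by (auto simp: w''_def split: if_splits)
        then show "v k = w'' k" using v by (simp add: w''_def)
      qed
    qed
    from least[OF this] l show False by blast
  qed
  with v have "\<forall>l\<in>D. v l = w l" by blast
  with D show "v \<in> F" by (simp add: determines_def)
qed

text \<open>If no fixed coordinate of \<open>F'\<close> lies over \<open>l\<close>, then changing
  \<open>w\<close> at \<open>l\<close> alters \<open>w \<circ> h\<close> only in free coordinates,
  so \<open>l\<close> is not fixed in \<open>F\<close>.\<close>

lemma fixed_coords_reindex:
  assumes F': "subcube F'" and h: "\<And>w. w \<circ> h \<in> F' \<longleftrightarrow> w \<in> F" and "F \<noteq> {}"
  shows "fixed_coords F \<subseteq> h ` fixed_coords F'"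
proof (rule ccontr)
  assume "\<not> fixed_coords F \<subseteq> h ` fixed_coords F'"
  then obtain l where l: "l \<in> fixed_coords F" "l \<notin> h ` fixed_coords F'" by blast
  obtain w where w: "w \<in> F" using \<open>F \<noteq> {}\<close> by blast
  obtain u where u: "u \<noteq> w l" using other_element by blast
  have "w(l := u) \<circ> h \<in> F'"
    by (rule subcubeD[OF F', of "w \<circ> h"]) (use w h l in auto)
  then have "w(l := u) \<in> F" by (simp only: h)
  then show False using fixed_coordsD[OF l(1) w] u by fastforce
qed

text \<open>Greedy choice: \<open>D\<close> collects the coordinates already used. It is smaller
  than each \<open>I c\<close> still to be treated, so a fresh coordinate is available there and
  earlier choices stay intact.\<close>

lemma avoid_subcubes:
  fixes I :: "'c \<Rightarrow> nat set" and w :: "'c \<Rightarrow> nat \<Rightarrow> 3"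
  assumes "finite Z" "card Z \<le> M" "\<And>c. c \<in> Z \<Longrightarrow> M \<le> card (I c)"
  shows "\<exists>v D. finite D \<and> card D \<le> card Z \<and>
    (\<forall>v'. (\<forall>l\<in>D. v' l = v l) \<longrightarrow> (\<forall>c\<in>Z. \<exists>l\<in>I c. v' l \<noteq> w c l))"
  using assms
proof (induction Z rule: finite_induct)
  case empty
  then show ?case by (intro exI[of _ "\<lambda>_. 0"] exI[of _ "{}"]) auto
next
  case (insert c Z)
  then have "\<exists>v D. finite D \<and> card D \<le> card Z \<and>
    (\<forall>v'. (\<forall>l\<in>D. v' l = v l) \<longrightarrow> (\<forall>c\<in>Z. \<exists>l\<in>I c. v' l \<noteq> w c l))"
    by (intro insert.IH) auto
  then obtain v D where D: "finite D" "card D \<le> card Z"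
    and v: "\<forall>v'. (\<forall>l\<in>D. v' l = v l) \<longrightarrow> (\<forall>d\<in>Z. \<exists>l\<in>I d. v' l \<noteq> w d l)"
    by blast
  have "card D < card (I c)"
    using insert.hyps insert.prems(1) insert.prems(2)[of c] D by simp
  then have "\<not> I c \<subseteq> D"
    using card_mono[OF D(1)] by (meson not_less)
  then obtain l where l: "l \<in> I c" "l \<notin> D" by blast
  obtain u where u: "u \<noteq> w c l" using other_element by blast
  show ?case
  proof (intro exI[of _ "v(l := u)"] exI[of _ "insert l D"] conjI allI impI ballI)
    show "card (insert l D) \<le> card (insert c Z)"
      using insert.hyps D l by simp
    fix v' d assume v': "\<forall>k\<in>insert l D. v' k = (v(l := u)) k" and d: "d \<in> insert c Z"
    show "\<exists>k\<in>I d. v' k \<noteq> w d k"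
    proof (cases "d = c")
      case True
      then show ?thesis using v' l u by auto
    next
      case False
      moreover have "\<forall>k\<in>D. v' k = v k" using v' l(2) by auto
      ultimately show ?thesis using v d by blast
    qed
  qed (use D in simp)
qed

section \<open>Loops modulo orbits\<close>

context finite_orbit_clone
begin

text \<open>Star composition: \<open>\<psi>\<close> stands in every argument of
  \<open>\<phi>\<close>, each copy on its own block of variables. The pairing function makes the
  blocks disjoint.\<close>

definition star :: "((nat \<Rightarrow> 'b) \<Rightarrow> 'b) \<Rightarrow> ((nat \<Rightarrow> 'b) \<Rightarrow> 'b) \<Rightarrow> (nat \<Rightarrow> 'b) \<Rightarrow> 'b" where
  "star \<phi> \<psi> = (\<lambda>x. \<phi> (\<lambda>j. \<psi> (\<lambda>l. x (prod_encode (j, l)))))"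

lemma star_in: "\<phi> \<in> T \<Longrightarrow> \<psi> \<in> T \<Longrightarrow> star \<phi> \<psi> \<in> T"
  unfolding star_def
  by (rule comp_in, assumption) (rule comp_in[of \<psi>], assumption, rule proj_in)

definition words :: "((nat \<Rightarrow> 'b) \<Rightarrow> 'b) \<Rightarrow> (3 \<Rightarrow> 'b) \<Rightarrow> 'b set \<Rightarrow> (nat \<Rightarrow> 3) set" where
  "words \<phi> e U = {w. \<phi> (e \<circ> w) \<in> U}"

lemma words_finitary:
  assumes "\<phi> \<in> T" "invariant U"
  shows "\<exists>n. \<forall>v w. (\<forall>l<n. v l = w l) \<longrightarrow> v \<in> words \<phi> e U \<longrightarrow> w \<in> words \<phi> e U"
proof -
  obtain n where "\<And>x y. (\<forall>i<n. x i = y i) \<Longrightarrow> (\<phi> x, \<phi> y) \<in> E"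
    using finitary[OF assms(1)] by blast
  then show ?thesis
    using invariant_E[OF assms(2)] unfolding words_def
    by (intro exI[of _ n]) auto
qed

end

locale triangle_in_graph = finite_orbit_clone T E for T and E :: "'b rel" +
  fixes R :: "'b rel" and e :: "3 \<Rightarrow> 'b"
  assumes sym_R: "sym R" and inv_R: "invariant_rel R"
    and triangle: "u \<noteq> v \<Longrightarrow> (e u, e v) \<in> R"
begin

abbreviation W :: "((nat \<Rightarrow> 'b) \<Rightarrow> 'b) \<Rightarrow> 'b set \<Rightarrow> (nat \<Rightarrow> 3) set" where
  "W \<phi> U \<equiv> words \<phi> e U"

abbreviation I :: "((nat \<Rightarrow> 'b) \<Rightarrow> 'b) \<Rightarrow> 'b set \<Rightarrow> nat set" where
  "I \<phi> U \<equiv> fixed_coords (words \<phi> e U)"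

lemma words_adjacent:
  "\<phi> \<in> T \<Longrightarrow> (\<And>l. v l \<noteq> w l) \<Longrightarrow> (\<phi> (e \<circ> v), \<phi> (e \<circ> w)) \<in> R"
  by (rule invariant_rel_apply[OF inv_R]) (simp_all add: triangle)

text \<open>In each coordinate \<open>third_vertices\<close> supplies \<open>y\<close> and
  \<open>z\<close> such that \<open>v\<close>, \<open>y\<close>, \<open>z\<close> form a triangle,
  \<open>y\<close> avoids \<open>w\<close> and \<open>z\<close> avoids \<open>w'\<close>. The images
  of \<open>y\<close> and \<open>z\<close> are then adjacent to \<open>U\<close>, so
  \<open>triangle_closed\<close> puts the image of \<open>v\<close> into \<open>U\<close>.\<close>

lemma subcube_words:
  assumes U: "triangle_closed R U" and \<phi>: "\<phi> \<in> T" and ne: "W \<phi> U \<noteq> {}"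
  shows "subcube (W \<phi> U)"
proof -
  have "invariant U" using U by (simp add: triangle_closed_def)
  then obtain n where n: "\<And>v w. (\<forall>l<n. v l = w l) \<Longrightarrow> v \<in> W \<phi> U \<Longrightarrow> w \<in> W \<phi> U"
    using words_finitary[OF \<phi>, of U e] by metis
  show ?thesis
  proof (rule subcubeI[of n])
    show "w \<in> W \<phi> U" if "\<And>l. l < n \<Longrightarrow> v l = w l" "v \<in> W \<phi> U" for v w
      using n that by blast
    fix w w' v assume w: "w \<in> W \<phi> U" and w': "w' \<in> W \<phi> U" and v: "\<And>l. w l = w' l \<Longrightarrow> v l = w l"
    have "\<forall>l. \<exists>y z. y \<noteq> v l \<and> y \<noteq> z \<and> z \<noteq> v l \<and> y \<noteq> w l \<and> z \<noteq> w' l"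
      using v by (intro allI third_vertices) simp
    then obtain y z where yz: "\<forall>l. y l \<noteq> v l \<and> y l \<noteq> z l \<and> z l \<noteq> v l \<and> y l \<noteq> w l \<and> z l \<noteq> w' l"
      by metis
    have adj: "(\<phi> (e \<circ> v), \<phi> (e \<circ> y)) \<in> R" "(\<phi> (e \<circ> y), \<phi> (e \<circ> z)) \<in> R" "(\<phi> (e \<circ> z), \<phi> (e \<circ> v)) \<in> R"
      "(\<phi> (e \<circ> w), \<phi> (e \<circ> y)) \<in> R" "(\<phi> (e \<circ> w'), \<phi> (e \<circ> z)) \<in> R"
      by (rule words_adjacent[OF \<phi>], use yz in \<open>simp add: eq_commute\<close>)+
    have "\<phi> (e \<circ> y) \<in> R `` U" "\<phi> (e \<circ> z) \<in> R `` U"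
      using adj w w' by (auto simp: words_def)
    with adj U have "\<phi> (e \<circ> v) \<in> U"
      unfolding triangle_closed_def by blast
    then show "v \<in> W \<phi> U" by (simp add: words_def)
  qed (fact ne)
qed

text \<open>Otherwise \<open>U\<close> would contain the images of all words, among them those of
  two constant words that differ everywhere, and hence an edge.\<close>

lemma fixed_coords_nonempty:
  assumes U: "triangle_closed R U" and \<phi>: "\<phi> \<in> T" and ne: "W \<phi> U \<noteq> {}"
  shows "I \<phi> U \<noteq> {}"
proof
  assume "I \<phi> U = {}"
  then have all: "v \<in> W \<phi> U" for v
    using subcubeD[OF subcube_words[OF assms]] ne by blast
  have "(\<phi> (e \<circ> (\<lambda>_. 1)), \<phi> (e \<circ> (\<lambda>_. 2))) \<in> R"
    by (rule words_adjacent[OF \<phi>]) simp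
  moreover have "\<phi> (e \<circ> (\<lambda>_. 1)) \<in> U" "\<phi> (e \<circ> (\<lambda>_. 2)) \<in> U"
    using all unfolding words_def by blast+
  ultimately show False using U unfolding triangle_closed_def by blast
qed

section \<open>Fixed coordinates of star compositions\<close>

lemma star_diagonal:
  assumes "triangle_closed R U" "\<phi> \<in> T"
  shows "w \<circ> (snd \<circ> prod_decode) \<in> W (star \<phi> \<psi>) U \<longleftrightarrow> w \<in> W \<psi> U"
proof -
  have "star \<phi> \<psi> (e \<circ> (w \<circ> (snd \<circ> prod_decode))) = \<phi> (\<lambda>_. \<psi> (e \<circ> w))"
    by (simp add: star_def o_def)
  moreover have "(\<phi> (\<lambda>_. \<psi> (e \<circ> w)), \<psi> (e \<circ> w)) \<in> E"
    by (rule diagonal_E[OF assms(2)])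
  ultimately show ?thesis
    using invariant_E_iff assms(1) by (simp add: words_def triangle_closed_def)
qed

text \<open>On words constant on each block idempotence of \<open>\<psi>\<close> leaves exactly
  \<open>\<phi>\<close>. On words repeated in all blocks, as in \<open>star_diagonal\<close>, the
  outer operation acts by its diagonal, which preserves orbits.\<close>

lemma star_constant_blocks:
  assumes "\<And>u. \<psi> (\<lambda>_. e u) = e u"
  shows "w \<circ> (fst \<circ> prod_decode) \<in> W (star \<phi> \<psi>) U \<longleftrightarrow> w \<in> W \<phi> U"
proof -
  have "star \<phi> \<psi> (e \<circ> (w \<circ> (fst \<circ> prod_decode))) = \<phi> (e \<circ> w)"
    by (simp add: star_def o_def assms)
  then show ?thesis by (simp add: words_def)
qed

lemma fixed_coords_star_inner:
  assumes U: "triangle_closed R U" and "\<phi> \<in> T" "\<psi> \<in> T" and ne: "W \<psi> U \<noteq> {}"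
  shows "W (star \<phi> \<psi>) U \<noteq> {}" "subcube (W (star \<phi> \<psi>) U)"
    "I \<psi> U \<subseteq> (snd \<circ> prod_decode) ` I (star \<phi> \<psi>) U"
proof -
  show ne': "W (star \<phi> \<psi>) U \<noteq> {}"
  proof -
    obtain w where "w \<in> W \<psi> U" using ne by blast
    then have "w \<circ> (snd \<circ> prod_decode) \<in> W (star \<phi> \<psi>) U"
      by (simp only: star_diagonal[OF assms(1,2)])
    then show ?thesis by blast
  qed
  show sub: "subcube (W (star \<phi> \<psi>) U)"
    by (rule subcube_words[OF U star_in ne']) fact+
  show "I \<psi> U \<subseteq> (snd \<circ> prod_decode) ` I (star \<phi> \<psi>) U"
    by (rule fixed_coords_reindex[OF sub star_diagonal ne]) fact+
qed

lemma card_fixed_coords_star_inner: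
  assumes U: "triangle_closed R U" and "\<phi> \<in> T" "\<psi> \<in> T" and ne: "W \<psi> U \<noteq> {}"
  shows "card (I \<psi> U) \<le> card (I (star \<phi> \<psi>) U)"
  using fixed_coords_star_inner[OF assms] surj_card_le by (auto simp: subcube_def)

lemma fixed_coords_star_outer:
  assumes U: "triangle_closed R U" and "\<phi> \<in> T" "\<psi> \<in> T" and ne: "W \<phi> U \<noteq> {}"
    and idem: "\<And>u. \<psi> (\<lambda>_. e u) = e u"
  shows "W (star \<phi> \<psi>) U \<noteq> {}" "card (I \<phi> U) \<le> card (I (star \<phi> \<psi>) U)"
proof -
  show ne': "W (star \<phi> \<psi>) U \<noteq> {}"
  proof -
    obtain w where "w \<in> W \<phi> U" using ne by blast
    then have "w \<circ> (fst \<circ> prod_decode) \<in> W (star \<phi> \<psi>) U"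
      by (simp only: star_constant_blocks[OF idem])
    then show ?thesis by blast
  qed
  have sub: "subcube (W (star \<phi> \<psi>) U)"
    by (rule subcube_words[OF U star_in ne']) fact+
  have "I \<phi> U \<subseteq> (fst \<circ> prod_decode) ` I (star \<phi> \<psi>) U"
    by (rule fixed_coords_reindex[OF sub star_constant_blocks[OF idem] ne])
  then show "card (I \<phi> U) \<le> card (I (star \<phi> \<psi>) U)"
    using sub surj_card_le by (auto simp: subcube_def)
qed

text \<open>A change within orbits does not affect membership in an invariant set.\<close>

lemma idempotent_on_triangle:
  assumes "\<phi> \<in> T"
  shows "\<exists>\<psi>\<in>T. (\<forall>u. \<psi> (\<lambda>_. e u) = e u) \<and> (\<forall>U. triangle_closed R U \<longrightarrow> W \<psi> U = W \<phi> U)"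
proof -
  obtain \<psi> where "\<psi> \<in> T" and idem: "\<forall>x\<in>range e. \<psi> (\<lambda>_. x) = x" and eq: "\<And>x. (\<phi> x, \<psi> x) \<in> E"
    using idempotent_op[OF assms, of "range e"] by auto
  have "W \<psi> U = W \<phi> U" if "triangle_closed R U" for U
    using that invariant_E_iff[OF _ eq] by (simp add: triangle_closed_def words_def)
  with \<open>\<psi> \<in> T\<close> idem show ?thesis by blast
qed

text \<open>
  Otherwise some operation would fix, for each of the finitely many sets \<open>U\<close>, more coordinates
  than there are such sets; changing one coordinate for each \<open>U\<close> then gives a word that no
  \<open>U\<close> covers.
\<close>

lemma bounded_fixed_coords:
  assumes cover: "\<And>a. a \<in> triangle_vertices R \<Longrightarrow> \<exists>U. triangle_closed R U \<and> a \<in> U"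
  shows "\<exists>U \<phi>. triangle_closed R U \<and> \<phi> \<in> T \<and> W \<phi> U \<noteq> {} \<and>
    (\<forall>\<psi>. \<psi> \<in> T \<and> W \<psi> U \<noteq> {} \<longrightarrow> card (I \<psi> U) \<le> card (I \<phi> U))"
proof (rule ccontr)
  assume no_max: "\<not> ?thesis"
  \<comment> \<open>Only sets that are reached by some operation need to be avoided; any set
    containing an image of a word is of this kind.\<close>
  define P where "P = {U. triangle_closed R U \<and> (\<exists>\<phi>\<in>T. W \<phi> U \<noteq> {})}"
  have fin: "finite P"
    by (rule finite_subset[OF _ finite_invariant]) (auto simp: P_def triangle_closed_def)
  have unbounded: "\<exists>\<psi>\<in>T. W \<psi> U \<noteq> {} \<and> M \<le> card (I \<psi> U)" if U: "U \<in> P" for U M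
  proof (rule ccontr)
    assume "\<not> ?thesis"
    then have "\<forall>\<psi>. \<psi> \<in> T \<and> W \<psi> U \<noteq> {} \<longrightarrow> card (I \<psi> U) \<le> M" by force
    moreover obtain \<phi> where "\<phi> \<in> T \<and> W \<phi> U \<noteq> {}" using U by (auto simp: P_def)
    ultimately have "\<exists>\<phi>. (\<phi> \<in> T \<and> W \<phi> U \<noteq> {}) \<and>
        (\<forall>\<psi>. \<psi> \<in> T \<and> W \<psi> U \<noteq> {} \<longrightarrow> card (I \<psi> U) \<le> card (I \<phi> U))"
      by (intro ex_has_greatest_nat[of "\<lambda>\<phi>. \<phi> \<in> T \<and> W \<phi> U \<noteq> {}" _ "\<lambda>\<phi>. card (I \<phi> U)" "Suc M"])
        (auto simp: less_Suc_eq_le)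
    with no_max U show False unfolding P_def by blast
  qed
  \<comment> \<open>One operation serves all sets of \<open>Z\<close> at once: in a star composition
    the inner factor takes care of the sets already treated and the outer one of the new set. The
    latter requires the inner factor to be idempotent on the triangle.\<close>
  have "\<exists>\<phi>\<in>T. (\<forall>u. \<phi> (\<lambda>_. e u) = e u) \<and> (\<forall>U\<in>Z. W \<phi> U \<noteq> {} \<and> M \<le> card (I \<phi> U))"
    if "finite Z" "Z \<subseteq> P" for Z M
    using that
  proof (induction Z rule: finite_induct)
    case empty
    show ?case by (intro bexI[of _ "\<lambda>x. x 0"]) (simp_all add: proj_in)
  next
    case (insert U Z)
    then obtain \<phi> where \<phi>: "\<phi> \<in> T" "\<And>u. \<phi> (\<lambda>_. e u) = e u"
      and Z: "\<forall>V\<in>Z. W \<phi> V \<noteq> {} \<and> M \<le> card (I \<phi> V)"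
      by auto
    have U: "U \<in> P" "triangle_closed R U" using insert.prems by (auto simp: P_def)
    obtain \<psi>0 where "\<psi>0 \<in> T" "W \<psi>0 U \<noteq> {}" "M \<le> card (I \<psi>0 U)"
      using unbounded[OF U(1)] by blast
    then obtain \<psi> where \<psi>: "\<psi> \<in> T" "\<And>u. \<psi> (\<lambda>_. e u) = e u" "W \<psi> U \<noteq> {}" "M \<le> card (I \<psi> U)"
      using idempotent_on_triangle[of \<psi>0] U(2) by metis
    show ?case
    proof (intro bexI[of _ "star \<psi> \<phi>"] conjI allI ballI)
      show "star \<psi> \<phi> \<in> T" by (rule star_in) fact+
      show "star \<psi> \<phi> (\<lambda>_. e u) = e u" for u by (simp add: star_def \<phi> \<psi>)
      fix V assume V: "V \<in> insert U Z"
      show "W (star \<psi> \<phi>) V \<noteq> {}"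
      proof (cases "V = U")
        case True
        then show ?thesis using fixed_coords_star_outer(1)[OF U(2) \<psi>(1) \<phi>(1) \<psi>(3) \<phi>(2)] by simp
      next
        case False
        then have "V \<in> Z" "triangle_closed R V" using V insert.prems by (auto simp: P_def)
        then show ?thesis using fixed_coords_star_inner(1)[OF _ \<psi>(1) \<phi>(1)] Z by blast
      qed
      show "M \<le> card (I (star \<psi> \<phi>) V)"
      proof (cases "V = U")
        case True
        then show ?thesis using fixed_coords_star_outer(2)[OF U(2) \<psi>(1) \<phi>(1) \<psi>(3) \<phi>(2)] \<psi>(4) by simp
      next
        case False
        then have "V \<in> Z" "triangle_closed R V" using V insert.prems by (auto simp: P_def)
        then show ?thesis using card_fixed_coords_star_inner[OF _ \<psi>(1) \<phi>(1)] Z le_trans by blast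
      qed
    qed
  qed
  from this[OF fin subset_refl, of "card P"] obtain \<phi> where \<phi>: "\<phi> \<in> T"
    and big: "\<And>U. U \<in> P \<Longrightarrow> W \<phi> U \<noteq> {}" "\<And>U. U \<in> P \<Longrightarrow> card P \<le> card (I \<phi> U)"
    by blast
  define w where "w U = (SOME v. v \<in> W \<phi> U)" for U
  have w: "w U \<in> W \<phi> U" if "U \<in> P" for U
    using big(1)[OF that] unfolding w_def by (simp add: some_in_eq)
  obtain v where v: "\<And>U. U \<in> P \<Longrightarrow> \<exists>l\<in>I \<phi> U. v l \<noteq> w U l"
    using avoid_subcubes[OF fin order_refl, where I = "I \<phi>" and w = w] big(2) by blast
  \<comment> \<open>The words \<open>v\<close>, \<open>v + 1\<close>, \<open>v + 2\<close> differ
    pairwise in every coordinate.\<close>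
  have "\<phi> (e \<circ> v) \<in> triangle_vertices R"
    unfolding triangle_vertices_def
    by (intro CollectI exI[of _ "\<phi> (e \<circ> (\<lambda>l. v l + 1))"] exI[of _ "\<phi> (e \<circ> (\<lambda>l. v l + 2))"] conjI
        words_adjacent[OF \<phi>]) auto
  then obtain U where U: "triangle_closed R U" "v \<in> W \<phi> U"
    using cover by (auto simp: words_def)
  then have "U \<in> P" using \<phi> by (auto simp: P_def)
  with v obtain l where "l \<in> I \<phi> U" "v l \<noteq> w U l" by blast
  with fixed_coordsD U(2) w[OF \<open>U \<in> P\<close>] show False by blast
qed

end


text \<open>The outer unary functions of the pseudo-Taylor equations are absorbed by
  \<open>E\<close>. The matrices \<open>a\<close> and \<open>b\<close> record the positions of the
  first variable.\<close>

theorem (in finite_orbit_clone) loop_modulo_orbits: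
  assumes sym: "sym R" and inv: "invariant_rel R" and tri: "triangle_vertices R \<noteq> {}"
    and \<tau>: "\<tau> \<in> T" "\<And>x y. (\<And>i. i < n \<Longrightarrow> x i = y i) \<Longrightarrow> (\<tau> x, \<tau> y) \<in> E"
    and diag: "\<And>i. i < n \<Longrightarrow> a i i" "\<And>i. i < n \<Longrightarrow> \<not> b i i"
    and taylor: "\<And>i x y. i < n \<Longrightarrow>
      (\<tau> (\<lambda>j. if a i j then x else y), \<tau> (\<lambda>j. if b i j then x else y)) \<in> E"
  shows "R \<inter> E \<noteq> {}"
proof
  assume "R \<inter> E = {}"
  then have "loopless_graph R"
    using sym inv tri by (simp add: loopless_graph_def)
  then obtain S where S: "loopless_graph S" and least: "\<And>S'. loopless_graph S' \<Longrightarrow>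
      card (orbits_meeting (triangle_vertices S)) \<le> card (orbits_meeting (triangle_vertices S'))"
    using ex_has_least_nat[of loopless_graph R "\<lambda>S. card (orbits_meeting (triangle_vertices S))"]
    by blast
  have sym_S: "sym S" and inv_S: "invariant_rel S"
    using S by (auto simp: loopless_graph_def)
  obtain x y z where xyz: "(x, y) \<in> S" "(y, z) \<in> S" "(z, x) \<in> S"
    using S by (auto simp: loopless_graph_def triangle_vertices_def)
  define e :: "3 \<Rightarrow> 'b" where "e u = (if u = 1 then x else if u = 2 then y else z)" for u
  interpret triangle_in_graph T E S e
  proof
    fix u v :: 3 assume "u \<noteq> v"
    then show "(e u, e v) \<in> S"
      using xyz xyz[THEN symD[OF sym_S]] exhaust_3[of u] exhaust_3[of v]
      by (auto simp: e_def)
  qed fact+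
  obtain U \<phi> where U: "triangle_closed S U" and \<phi>: "\<phi> \<in> T" "W \<phi> U \<noteq> {}"
    and max: "\<And>\<psi>. \<psi> \<in> T \<Longrightarrow> W \<psi> U \<noteq> {} \<Longrightarrow> card (I \<psi> U) \<le> card (I \<phi> U)"
    using bounded_fixed_coords[OF triangle_closed_cover[OF S least]] by blast
  have inv_U: "invariant U" using U by (simp add: triangle_closed_def)
  define \<sigma> where "\<sigma> = star \<tau> \<phi>"
  have \<sigma>: "W \<sigma> U \<noteq> {}" "subcube (W \<sigma> U)" "I \<phi> U \<subseteq> (snd \<circ> prod_decode) ` I \<sigma> U"
    unfolding \<sigma>_def using fixed_coords_star_inner[OF U \<tau>(1) \<phi>] by blast+
  have fin: "finite (I \<sigma> U)" using \<sigma>(2) by (simp add: subcube_def)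
  \<comment> \<open>By maximality of \<open>\<phi>\<close>, the projection of
    \<open>I \<sigma> U\<close> to inner coordinates, which covers \<open>I \<phi> U\<close>, has no
    room for collisions: no inner coordinate is fixed in two blocks.\<close>
  have "card (I \<sigma> U) \<le> card (I \<phi> U)"
    unfolding \<sigma>_def using max star_in \<tau>(1) \<phi>(1) \<sigma>(1) by (simp add: \<sigma>_def)
  moreover have "card (I \<phi> U) \<le> card ((snd \<circ> prod_decode) ` I \<sigma> U)"
    using \<sigma>(3) fin by (intro card_mono) auto
  ultimately have "card (I \<sigma> U) \<le> card ((snd \<circ> prod_decode) ` I \<sigma> U)" by simp
  then have inj: "inj_on (snd \<circ> prod_decode) (I \<sigma> U)"
    using fin by (simp add: eq_card_imp_inj_on card_image_le le_antisym)
  obtain l where l: "l \<in> I \<phi> U" using fixed_coords_nonempty[OF U \<phi>] by blast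
  with \<sigma>(3) obtain m where m: "m \<in> I \<sigma> U" "l = snd (prod_decode m)" by auto
  define i where "i = fst (prod_decode m)"
  have m_eq: "m = prod_encode (i, l)" by (simp add: i_def m(2))
  obtain p where p: "p \<in> W \<phi> U" using \<phi>(2) by blast
  define p' where "p' = p \<circ> (snd \<circ> prod_decode)"
  have p': "p' \<in> W \<sigma> U"
    unfolding p'_def \<sigma>_def using star_diagonal[OF U \<tau>(1)] p by blast
  obtain u where u: "u \<noteq> p l" using other_element by blast
  \<comment> \<open>From block \<open>n\<close> on, changes of the word move the value of
    \<open>\<sigma>\<close> within an orbit only, so no coordinate there is fixed.\<close>
  have "i < n"
  proof (rule ccontr)
    assume "\<not> i < n"
    then have "(\<sigma> (e \<circ> p'), \<sigma> (e \<circ> p'(m := u))) \<in> E"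
      unfolding \<sigma>_def star_def by (intro \<tau>(2)) (simp add: m_eq o_def)
    then have "p'(m := u) \<in> W \<sigma> U"
      using p' invariant_E[OF inv_U] by (auto simp: words_def)
    from fixed_coordsD[OF m(1) this p'] u show False
      by (simp add: p'_def m_eq)
  qed
  define q where "q = p(l := u)"
  \<comment> \<open>The word with \<open>p\<close> in the blocks chosen by \<open>c\<close> and
    \<open>q\<close> in the others; the rows \<open>a i\<close> and \<open>b i\<close> give the two
    sides of the \<open>i\<close>-th equation.\<close>
  define P where "P c k = (case prod_decode k of (j, l') \<Rightarrow> if c j then p l' else q l')"
    for c :: "nat \<Rightarrow> bool" and k
  have eval: "\<sigma> (e \<circ> P c) = \<tau> (\<lambda>j. if c j then \<phi> (e \<circ> p) else \<phi> (e \<circ> q))" for c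
    unfolding \<sigma>_def star_def by (intro arg_cong[of _ _ \<tau>] ext) (simp add: P_def o_def)
  \<comment> \<open>This word differs from \<open>p'\<close> at most in copies of the coordinate
    \<open>l\<close>. Only the copy in block \<open>i\<close> is fixed, and that block carries
    \<open>p\<close> because \<open>a i i\<close> holds. In \<open>P (b i)\<close> it carries
    \<open>q\<close>, which gives the contradiction.\<close>
  have "P (a i) \<in> W \<sigma> U"
  proof (rule subcubeD[OF \<sigma>(2) p'])
    fix k assume k: "k \<in> I \<sigma> U"
    obtain j l' where jl: "prod_decode k = (j, l')" by force
    show "P (a i) k = p' k"
    proof (cases "l' = l")
      case True
      then have "k = m" using inj_onD[OF inj _ k m(1)] m(2) jl by simp
      then show ?thesis
        using diag(1)[OF \<open>i < n\<close>] by (simp add: P_def p'_def m_eq)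
    next
      case False
      then show ?thesis by (simp add: P_def p'_def jl q_def)
    qed
  qed
  moreover have "(\<sigma> (e \<circ> P (a i)), \<sigma> (e \<circ> P (b i))) \<in> E"
    unfolding eval by (rule taylor) fact
  ultimately have "P (b i) \<in> W \<sigma> U"
    using invariant_E[OF inv_U] by (simp add: words_def)
  from fixed_coordsD[OF m(1) this p'] show False
    using diag(2)[OF \<open>i < n\<close>] u by (simp add: P_def p'_def m_eq q_def)
qed

section \<open>Density and closure\<close>

lemma nary_extensional:
  assumes "clone \<C>" "f \<in> nary \<C> n"
  shows "f \<in> tuples n \<rightarrow>\<^sub>E UNIV"
  using assms by (auto simp: clone_def nary_def finitary_operations_def)

lemma nary_compose:
  assumes "clone \<C>" "f \<in> nary \<C> n" "\<And>j. j < n \<Longrightarrow> g j \<in> nary \<C> m"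
  shows "\<exists>h\<in>nary \<C> m. \<forall>xs. length xs = m \<longrightarrow> h xs = f (map (\<lambda>j. g j xs) [0..<n])"
proof
  have "\<forall>m n f gs. f \<in> nary \<C> n \<and> length gs = n \<and> set gs \<subseteq> nary \<C> m
      \<longrightarrow> composition m f gs \<in> nary \<C> m"
    using assms(1) unfolding clone_def by (elim conjE)
  moreover have "set (map g [0..<n]) \<subseteq> nary \<C> m" using assms(3) by auto
  ultimately show "composition m f (map g [0..<n]) \<in> nary \<C> m"
    using assms(2) by (metis diff_zero length_map length_upt)
qed (simp add: composition_def tuples_def o_def)

lemma nary_reindex:
  assumes "clone \<C>" "f \<in> nary \<C> n" "\<And>j. j < n \<Longrightarrow> \<pi> j < m"
  shows "\<exists>h\<in>nary \<C> m. \<forall>xs. length xs = m \<longrightarrow> h xs = f (map (\<lambda>j. xs ! \<pi> j) [0..<n])"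
proof -
  have "projection m (\<pi> j) \<in> nary \<C> m" if "j < n" for j
    using assms that by (simp add: clone_def)
  from nary_compose[OF assms(1,2) this] show ?thesis
    by (simp add: projection_def tuples_def cong: map_cong)
qed

section \<open>The group of invertible unary operations\<close>

lemma Gr_iff:
  "g \<in> carrier (Gr \<C>) \<longleftrightarrow>
     bij g \<and> unary_op g \<in> nary \<C> 1 \<and> unary_op (inv_into UNIV g) \<in> nary \<C> 1"
  by (simp add: Gr_def)

lemma Gr_mult_one: "monoid.mult (Gr \<C>) = (\<circ>)" "monoid.one (Gr \<C>) = id"
  by (simp_all add: Gr_def)

lemma Gr_comp: "clone \<C> \<Longrightarrow> g \<in> carrier (Gr \<C>) \<Longrightarrow> h \<in> carrier (Gr \<C>) \<Longrightarrow> g \<circ> h \<in> carrier (Gr \<C>)"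
  by (metis Gr_mult_one(1) group.is_monoid group_Gr monoid.m_closed)

lemma Gr_id: "clone \<C> \<Longrightarrow> id \<in> carrier (Gr \<C>)"
  by (metis Gr_mult_one(2) group.is_monoid group_Gr monoid.one_closed)

lemma Gr_inv: "g \<in> carrier (Gr \<C>) \<Longrightarrow> inv_into UNIV g \<in> carrier (Gr \<C>)"
  by (simp add: Gr_iff bij_imp_bij_inv inv_inv_eq)

lemma Gr_inv_apply:
  assumes "g \<in> carrier (Gr \<C>)"
  shows "inv_into UNIV g (g x) = x" "g (inv_into UNIV g x) = x"
  using assms by (simp_all add: Gr_iff bij_is_inj bij_is_surj surj_f_inv_f)

lemma Gr_nary_compose:
  assumes "clone \<C>" "g \<in> carrier (Gr \<C>)" "f \<in> nary \<C> n"
  shows "\<exists>h\<in>nary \<C> n. \<forall>xs. length xs = n \<longrightarrow> h xs = g (f xs)"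
  using nary_compose[of \<C> "unary_op g" 1 "\<lambda>_. f" n] assms
  by (simp add: Gr_iff unary_op_def tuples_def)

lemma openin_agreement:
  assumes "finite D" "f \<in> tuples n \<rightarrow>\<^sub>E UNIV"
  shows "openin (pointwise_topology n) {h \<in> tuples n \<rightarrow>\<^sub>E UNIV. \<forall>x\<in>D \<inter> tuples n. h x = f x}"
proof -
  let ?B = "\<lambda>x. if x \<in> D then {f x} else UNIV"
  have "openin (pointwise_topology n) (PiE (tuples n) ?B)"
    unfolding pointwise_topology_def openin_PiE_gen
    using assms(1) by (auto intro!: disjI2 intro: finite_subset[of _ D])
  moreover have "PiE (tuples n) ?B = {h \<in> tuples n \<rightarrow>\<^sub>E UNIV. \<forall>x\<in>D \<inter> tuples n. h x = f x}"
    by (auto simp: PiE_iff extensional_def split: if_splits)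
  ultimately show ?thesis by simp
qed

text \<open>Density is applied to the neighbourhood of \<open>f\<close> given by its values on the
  one-element lists over \<open>D\<close>.\<close>

lemma core_dense:
  assumes \<C>: "clone \<C>" "core \<C>" and f: "f \<in> nary \<C> 1" and "finite D"
  shows "\<exists>g\<in>carrier (Gr \<C>). \<forall>d\<in>D. f [d] = g d"
proof -
  let ?D = "(\<lambda>d. [d]) ` D"
  let ?U = "{h \<in> tuples 1 \<rightarrow>\<^sub>E UNIV. \<forall>x\<in>?D \<inter> tuples 1. h x = f x}"
  have f': "f \<in> tuples 1 \<rightarrow>\<^sub>E UNIV" using nary_extensional[OF \<C>(1) f] by simp
  have "f \<in> subtopology (pointwise_topology 1) (nary \<C> 1) closure_of (unary_op ` carrier (Gr \<C>))"
    using f \<C>(2) by (simp add: core_def)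
  then have closure: "\<exists>h. h \<in> unary_op ` carrier (Gr \<C>) \<and> h \<in> V"
    if "f \<in> V" "openin (subtopology (pointwise_topology 1) (nary \<C> 1)) V" for V
    using that by (simp only: in_closure_of)
  have "\<exists>h. h \<in> unary_op ` carrier (Gr \<C>) \<and> h \<in> ?U \<inter> nary \<C> 1"
  proof (rule closure)
    show "f \<in> ?U \<inter> nary \<C> 1" using f f' by simp
    show "openin (subtopology (pointwise_topology 1) (nary \<C> 1)) (?U \<inter> nary \<C> 1)"
      using openin_agreement[of ?D f 1] \<open>finite D\<close> f' by (intro openin_subtopology_Int) simp_all
  qed
  then obtain g where g: "g \<in> carrier (Gr \<C>)" "\<And>x. x \<in> ?D \<inter> tuples 1 \<Longrightarrow> unary_op g x = f x"
    by auto
  have "f [d] = g d" if "d \<in> D" for d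
    using g(2)[of "[d]"] that by (simp add: unary_op_def tuples_def)
  with g(1) show ?thesis by blast
qed

text \<open>Closedness in the sum topology passes to each arity. A basic neighbourhood of
  \<open>f\<close> in the complement would constrain only finitely many tuples, and some operation
  of the clone agrees with \<open>f\<close> on these.\<close>

lemma closed_operations_limit:
  fixes \<C> :: "'a operations"
  assumes "closed_operations \<C>" "n \<ge> 1" and f: "f \<in> tuples n \<rightarrow>\<^sub>E UNIV"
    and approx: "\<And>D. finite D \<Longrightarrow> D \<subseteq> tuples n \<Longrightarrow> \<exists>h\<in>nary \<C> n. \<forall>x\<in>D. h x = f x"
  shows "f \<in> nary \<C> n"
proof -
  have "closedin (pointwise_topology n) (nary \<C> n)"
    using assms(1,2) by (simp add: closed_operations_def operations_topology_def closedin_sum_topology nary_def)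
  then have op: "openin (pointwise_topology n) ((tuples n \<rightarrow>\<^sub>E UNIV) - nary \<C> n)"
    and sub: "nary \<C> n \<subseteq> tuples n \<rightarrow>\<^sub>E UNIV"
    by (auto simp: closedin_def pointwise_topology_def)
  show ?thesis
  proof (rule ccontr)
    assume "f \<notin> nary \<C> n"
    with f have "f \<in> (tuples n \<rightarrow>\<^sub>E UNIV) - nary \<C> n" by simp
    with op obtain B where B: "finite {x \<in> tuples n. B x \<noteq> topspace (discrete_topology UNIV)}"
      "f \<in> PiE (tuples n) B" "PiE (tuples n) B \<subseteq> (tuples n \<rightarrow>\<^sub>E UNIV) - nary \<C> n"
      unfolding pointwise_topology_def openin_product_topology_alt by blast
    define D where "D = {x \<in> tuples n. B x \<noteq> topspace (discrete_topology UNIV)}"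
    obtain h where h: "h \<in> nary \<C> n" "\<And>x. x \<in> D \<Longrightarrow> h x = f x"
      using approx[of D] B(1) by (auto simp: D_def)
    have "h \<in> PiE (tuples n) B"
    proof (rule PiE_I)
      fix x :: "'a list" assume "x \<in> tuples n"
      then show "h x \<in> B x" using h(2)[of x] B(2) by (cases "x \<in> D") (auto simp: D_def PiE_iff)
    next
      fix x :: "'a list" assume "x \<notin> tuples n"
      then show "h x = undefined" using h(1) sub by (auto simp: PiE_iff extensional_def)
    qed
    with B(3) h(1) show False by blast
  qed
qed

text \<open>
  A finite tuple is extended one entry at a time, keeping its orbit visited by infinitely many
  \<open>\<phi> j\<close>; only finitely many orbits compete at each step.
\<close>

lemma orbit_limit:
  fixes \<phi> :: "nat \<Rightarrow> nat \<Rightarrow> 'a"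
  assumes \<C>: "clone \<C>" "oligomorphic \<C>"
  shows "\<exists>\<psi>. \<forall>N. \<exists>j\<ge>N. \<exists>g\<in>carrier (Gr \<C>). \<forall>i<N. \<psi> i = g (\<phi> j i)"
proof -
  let ?G = "carrier (Gr \<C>)"
  define prefix where "prefix N j = map (\<phi> j) [0..<N]" for N j
  define visited where "visited s \<longleftrightarrow> infinite {j. \<exists>g\<in>?G. s = map g (prefix (length s) j)}" for s :: "'a list"
  have extend: "\<exists>x. visited (s @ [x])" if s: "visited s" for s
  proof -
    let ?n = "Suc (length s)"
    define J where "J = {j. \<exists>g\<in>?G. s = map g (prefix (length s) j)}"
    have "finite (orbits (Gr \<C>) (tuples ?n) map)"
      using \<C>(2) by (simp add: oligomorphic_def)
    moreover have "(\<lambda>j. orbit (Gr \<C>) map (prefix ?n j)) ` J \<subseteq> orbits (Gr \<C>) (tuples ?n) map"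
      by (auto simp: orbits_def tuples_def prefix_def)
    ultimately have "finite ((\<lambda>j. orbit (Gr \<C>) map (prefix ?n j)) ` J)"
      by (rule finite_subset[rotated])
    moreover have "infinite J" using s by (simp add: visited_def J_def)
    ultimately obtain k where k: "k \<in> J"
      and inf: "infinite {j\<in>J. orbit (Gr \<C>) map (prefix ?n j) = orbit (Gr \<C>) map (prefix ?n k)}"
      using pigeonhole_infinite[of J "\<lambda>j. orbit (Gr \<C>) map (prefix ?n j)"] by blast
    obtain g where g: "g \<in> ?G" "s = map g (prefix (length s) k)" using k by (auto simp: J_def)
    \<comment> \<open>The entry comes from one representative \<open>k\<close>. Every
      \<open>j\<close> whose longer prefix lies in the orbit of that of \<open>k\<close> can be
      carried to \<open>s @ [x]\<close> as well, and there are infinitely many such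
      \<open>j\<close>.\<close>
    define x where "x = g (\<phi> k (length s))"
    have sx: "s @ [x] = map g (prefix ?n k)"
      using g(2) by (simp add: prefix_def x_def)
    have "\<exists>h\<in>?G. s @ [x] = map h (prefix ?n j)"
      if "orbit (Gr \<C>) map (prefix ?n j) = orbit (Gr \<C>) map (prefix ?n k)" for j
    proof -
      have "prefix ?n k \<in> orbit (Gr \<C>) map (prefix ?n k)"
        using Gr_id[OF \<C>(1)] by (force simp: orbit_def)
      with that obtain h where "h \<in> ?G" "prefix ?n k = map h (prefix ?n j)"
        by (auto simp: orbit_def)
      with g(1) show ?thesis
        unfolding sx by (intro bexI[of _ "g \<circ> h"]) (simp_all add: Gr_comp[OF \<C>(1)])
    qed
    then have "{j\<in>J. orbit (Gr \<C>) map (prefix ?n j) = orbit (Gr \<C>) map (prefix ?n k)}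
        \<subseteq> {j. \<exists>h\<in>?G. s @ [x] = map h (prefix (length (s @ [x])) j)}"
      by auto
    with inf have "visited (s @ [x])" unfolding visited_def using finite_subset by blast
    then show ?thesis by blast
  qed
  have "visited []"
    using Gr_id[OF \<C>(1)] by (auto simp: visited_def prefix_def)
  then have "\<exists>s. visited s \<and> length s = 0" by auto
  moreover have "\<exists>t. (visited t \<and> length t = Suc N) \<and> (\<exists>x. t = s @ [x])"
    if s: "visited s \<and> length s = N" for s N
  proof -
    obtain x where "visited (s @ [x])" using extend s by blast
    then show ?thesis using s by (intro exI[of _ "s @ [x]"]) simp
  qed
  ultimately have "\<exists>s. \<forall>N. (visited (s N) \<and> length (s N) = N) \<and> (\<exists>x. s (Suc N) = s N @ [x])"
    by (rule dependent_nat_choice[of "\<lambda>N s. visited s \<and> length s = N" "\<lambda>_ s t. \<exists>x. t = s @ [x]"])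
  then obtain s where s: "\<And>N. visited (s N)" "\<And>N. length (s N) = N" "\<And>N. \<exists>x. s (Suc N) = s N @ [x]"
    by blast
  define \<psi> where "\<psi> i = s (Suc i) ! i" for i
  have \<psi>: "s N ! i = \<psi> i" if "i < N" for i N
    using that
  proof (induction N)
    case (Suc N)
    obtain x where "s (Suc N) = s N @ [x]" using s(3) by blast
    with Suc s(2)[of N] show ?case
      by (cases "i = N") (auto simp: \<psi>_def nth_append)
  qed simp
  have "\<exists>j\<ge>N. \<exists>g\<in>?G. \<forall>i<N. \<psi> i = g (\<phi> j i)" for N
  proof -
    have "infinite {j. \<exists>g\<in>?G. s N = map g (prefix N j)}"
      using s(1)[of N] by (simp add: visited_def s(2))
    then obtain j g where "j \<ge> N" "g \<in> ?G" and eq: "s N = map g (prefix N j)"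
      unfolding infinite_nat_iff_unbounded_le by blast
    moreover have "\<psi> i = g (\<phi> j i)" if "i < N" for i
      using \<psi>[OF that] that eq by (simp add: prefix_def)
    ultimately show ?thesis by blast
  qed
  then show ?thesis by blast
qed

section \<open>Finite powers\<close>

text \<open>
  The \<open>k\<close>-th power of the domain is represented by \<^typ>\<open>nat \<Rightarrow> 'a\<close>, where only the entries
  below \<open>k\<close> matter: the operations may behave arbitrarily on the other entries.
\<close>

definition power_operations :: "'a operations \<Rightarrow> nat \<Rightarrow> ((nat \<Rightarrow> nat \<Rightarrow> 'a) \<Rightarrow> nat \<Rightarrow> 'a) set" where
  "power_operations \<C> k =
     {\<phi>. \<exists>n. \<exists>f\<in>nary \<C> n. \<forall>x. \<forall>i<k. \<phi> x i = f (map (\<lambda>j. x j i) [0..<n])}"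

definition power_orbit_rel :: "'a operations \<Rightarrow> nat \<Rightarrow> (nat \<Rightarrow> 'a) rel" where
  "power_orbit_rel \<C> k = {(x, y). \<exists>g\<in>carrier (Gr \<C>). \<forall>i<k. y i = g (x i)}"

lemma power_operationsI:
  "f \<in> nary \<C> n \<Longrightarrow> (\<And>x i. i < k \<Longrightarrow> \<phi> x i = f (map (\<lambda>j. x j i) [0..<n])) \<Longrightarrow>
     \<phi> \<in> power_operations \<C> k"
  by (auto simp: power_operations_def)

lemma power_operationsE:
  assumes "\<phi> \<in> power_operations \<C> k"
  obtains n f where "f \<in> nary \<C> n" "\<And>x i. i < k \<Longrightarrow> \<phi> x i = f (map (\<lambda>j. x j i) [0..<n])"
  using assms by (auto simp: power_operations_def)

lemma power_orbit_relI:
  "g \<in> carrier (Gr \<C>) \<Longrightarrow> (\<And>i. i < k \<Longrightarrow> y i = g (x i)) \<Longrightarrow> (x, y) \<in> power_orbit_rel \<C> k"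
  by (auto simp: power_orbit_rel_def)

lemma equiv_power_orbit_rel:
  assumes "clone \<C>"
  shows "equiv UNIV (power_orbit_rel \<C> k)"
proof (rule equivI)
  show "refl (power_orbit_rel \<C> k)"
    using Gr_id[OF assms] by (intro refl_onI power_orbit_relI[of id]) auto
  show "sym (power_orbit_rel \<C> k)"
  proof (rule symI)
    fix x y assume "(x, y) \<in> power_orbit_rel \<C> k"
    then obtain g where g: "g \<in> carrier (Gr \<C>)" "\<forall>i<k. y i = g (x i)"
      by (auto simp: power_orbit_rel_def)
    show "(y, x) \<in> power_orbit_rel \<C> k"
      by (rule power_orbit_relI[OF Gr_inv[OF g(1)]]) (simp add: g Gr_inv_apply[OF g(1)])
  qed
  show "trans (power_orbit_rel \<C> k)"
  proof (rule transI)
    fix x y z assume "(x, y) \<in> power_orbit_rel \<C> k" "(y, z) \<in> power_orbit_rel \<C> k"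
    then obtain g h where "g \<in> carrier (Gr \<C>)" "\<forall>i<k. y i = g (x i)"
      "h \<in> carrier (Gr \<C>)" "\<forall>i<k. z i = h (y i)"
      by (auto simp: power_orbit_rel_def)
    then show "(x, z) \<in> power_orbit_rel \<C> k"
      by (intro power_orbit_relI[of "h \<circ> g"] Gr_comp[OF assms]) auto
  qed
qed simp

lemma finite_quotient_power_orbit_rel:
  assumes "oligomorphic \<C>" "k \<ge> 1"
  shows "finite (UNIV // power_orbit_rel \<C> k)"
proof (rule finite_subset)
  show "UNIV // power_orbit_rel \<C> k
      \<subseteq> (\<lambda>B. {y. map y [0..<k] \<in> B}) ` orbits (Gr \<C>) (tuples k) map"
  proof
    fix A assume "A \<in> UNIV // power_orbit_rel \<C> k"
    then obtain x where "A = power_orbit_rel \<C> k `` {x}" by (auto simp: quotient_def)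
    also have "\<dots> = {y. map y [0..<k] \<in> orbit (Gr \<C>) map (map x [0..<k])}"
      by (auto simp: power_orbit_rel_def orbit_def)
    finally have "A = {y. map y [0..<k] \<in> orbit (Gr \<C>) map (map x [0..<k])}" .
    moreover have "map x [0..<k] \<in> tuples k" by (simp add: tuples_def)
    ultimately show "A \<in> (\<lambda>B. {y. map y [0..<k] \<in> B}) ` orbits (Gr \<C>) (tuples k) map"
      unfolding orbits_def by blast
  qed
  show "finite ((\<lambda>B. {y. map y [0..<k] \<in> B}) ` orbits (Gr \<C>) (tuples k) map)"
    using assms by (simp add: oligomorphic_def)
qed

lemma power_operations_comp:
  assumes \<C>: "clone \<C>" and \<phi>: "\<phi> \<in> power_operations \<C> k" and \<psi>: "\<And>j. \<psi> j \<in> power_operations \<C> k"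
  shows "(\<lambda>x. \<phi> (\<lambda>j. \<psi> j x)) \<in> power_operations \<C> k"
proof -
  obtain n f where f: "f \<in> nary \<C> n" "\<And>x i. i < k \<Longrightarrow> \<phi> x i = f (map (\<lambda>j. x j i) [0..<n])"
    by (rule power_operationsE[OF \<phi>]) (rule that)
  have "\<forall>j. \<exists>m g. g \<in> nary \<C> m \<and> (\<forall>x. \<forall>i<k. \<psi> j x i = g (map (\<lambda>l. x l i) [0..<m]))"
    using \<psi> by (simp add: power_operations_def Bex_def)
  from choice[OF this] obtain m
    where "\<forall>j. \<exists>g. g \<in> nary \<C> (m j) \<and> (\<forall>x. \<forall>i<k. \<psi> j x i = g (map (\<lambda>l. x l i) [0..<m j]))" ..
  from choice[OF this] obtain g where g: "\<And>j. g j \<in> nary \<C> (m j)"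
    "\<And>j x i. i < k \<Longrightarrow> \<psi> j x i = g j (map (\<lambda>l. x l i) [0..<m j])"
    by auto
  \<comment> \<open>A common arity to which the \<open>n\<close> inner operations are
    padded.\<close>
  define M where "M = (\<Sum>j<n. m j)"
  have le: "m j \<le> M" if "j < n" for j
    using that unfolding M_def by (simp add: member_le_sum)
  have "\<exists>h\<in>nary \<C> M. \<forall>xs. length xs = M \<longrightarrow> h xs = g j (map (\<lambda>l. xs ! l) [0..<m j])" if "j < n" for j
    using nary_reindex[OF \<C> g(1)[of j], of "\<lambda>l. l" M] le[OF that] by simp
  then have "\<forall>j. \<exists>h. j < n \<longrightarrow>
      h \<in> nary \<C> M \<and> (\<forall>xs. length xs = M \<longrightarrow> h xs = g j (map (\<lambda>l. xs ! l) [0..<m j]))"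
    by blast
  from choice[OF this] obtain h where h: "\<And>j. j < n \<Longrightarrow> h j \<in> nary \<C> M"
    "\<And>j xs. j < n \<Longrightarrow> length xs = M \<Longrightarrow> h j xs = g j (map (\<lambda>l. xs ! l) [0..<m j])"
    by auto
  obtain H where H: "H \<in> nary \<C> M"
    "\<And>xs. length xs = M \<Longrightarrow> H xs = f (map (\<lambda>j. h j xs) [0..<n])"
    using nary_compose[OF \<C> f(1), of h M] h(1) by blast
  show ?thesis
  proof (rule power_operationsI[OF H(1)])
    fix x i assume "i < k"
    have "\<psi> j x i = h j (map (\<lambda>l. x l i) [0..<M])" if "j < n" for j
    proof -
      have "map (\<lambda>l. map (\<lambda>l. x l i) [0..<M] ! l) [0..<m j] = map (\<lambda>l. x l i) [0..<m j]"
        using le[OF that] by (intro map_cong) auto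
      then show ?thesis using that \<open>i < k\<close> by (simp add: g(2) h(2) del: map_eq_conv)
    qed
    then have "map (\<lambda>j. \<psi> j x i) [0..<n] = map (\<lambda>j. h j (map (\<lambda>l. x l i) [0..<M])) [0..<n]"
      by simp
    then show "\<phi> (\<lambda>j. \<psi> j x) i = H (map (\<lambda>l. x l i) [0..<M])"
      using \<open>i < k\<close> by (simp add: f(2) H(2) del: map_eq_conv)
  qed
qed

text \<open>By density, the diagonal of \<open>f\<close> agrees with a group element
  \<open>g\<close> on the finitely many entries that occur in \<open>B\<close>. Composition with the
  inverse of \<open>g\<close> makes it the identity there.\<close>

lemma power_operations_idempotent:
  assumes \<C>: "clone \<C>" "core \<C>" and \<phi>: "\<phi> \<in> power_operations \<C> k" and "finite B"
  shows "\<exists>\<psi>\<in>power_operations \<C> k. (\<forall>x\<in>B. \<psi> (\<lambda>_. x) = x) \<and> (\<forall>x. (\<phi> x, \<psi> x) \<in> power_orbit_rel \<C> k)"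
proof -
  obtain n f where f: "f \<in> nary \<C> n" "\<And>x i. i < k \<Longrightarrow> \<phi> x i = f (map (\<lambda>j. x j i) [0..<n])"
    by (rule power_operationsE[OF \<phi>]) (rule that)
  obtain d where d: "d \<in> nary \<C> 1" "\<And>xs. length xs = 1 \<Longrightarrow> d xs = f (map (\<lambda>j. xs ! 0) [0..<n])"
    using nary_reindex[OF \<C>(1) f(1), of "\<lambda>_. 0" 1] by auto
  have "finite (\<Union>x\<in>B. x ` {..<k})" using \<open>finite B\<close> by simp
  from core_dense[OF \<C> d(1) this] obtain g where g: "g \<in> carrier (Gr \<C>)"
    and "\<And>x i. x \<in> B \<Longrightarrow> i < k \<Longrightarrow> d [x i] = g (x i)"
    by blast
  then have diag: "\<phi> (\<lambda>_. x) i = g (x i)" if "x \<in> B" "i < k" for x i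
    using that d(2)[of "[x i]"] by (simp add: f(2))
  define g' where "g' = inv_into UNIV g"
  have g': "g' \<in> carrier (Gr \<C>)" "\<And>y. g' (g y) = y"
    using Gr_inv[OF g] Gr_inv_apply[OF g] by (simp_all add: g'_def)
  \<comment> \<open>The case distinction makes the equation on \<open>B\<close> literal also for
    entries from \<open>k\<close> on; below \<open>k\<close> both cases agree.\<close>
  define \<psi> where "\<psi> x = (if \<exists>y\<in>B. x = (\<lambda>_. y) then x 0 else (\<lambda>i. g' (\<phi> x i)))" for x
  have \<psi>: "\<psi> x i = g' (\<phi> x i)" if "i < k" for x i
    using that diag g'(2) by (auto simp: \<psi>_def)
  obtain h where h: "h \<in> nary \<C> n" "\<And>xs. length xs = n \<Longrightarrow> h xs = g' (f xs)"
    using Gr_nary_compose[OF \<C>(1) g'(1) f(1)] by blast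
  have "\<psi> \<in> power_operations \<C> k"
    by (rule power_operationsI[OF h(1)]) (simp add: \<psi> h(2) f(2))
  moreover have "\<forall>x\<in>B. \<psi> (\<lambda>_. x) = x" by (auto simp: \<psi>_def)
  moreover have "(\<phi> x, \<psi> x) \<in> power_orbit_rel \<C> k" for x
    by (rule power_orbit_relI[OF g'(1)]) (simp add: \<psi>)
  ultimately show ?thesis by blast
qed

lemma finite_orbit_clone_power:
  assumes \<C>: "clone \<C>" "oligomorphic \<C>" "core \<C>" and "k \<ge> 1"
  shows "finite_orbit_clone (power_operations \<C> k) (power_orbit_rel \<C> k)"
proof
  show "equiv UNIV (power_orbit_rel \<C> k)" by (rule equiv_power_orbit_rel) fact
  show "finite (UNIV // power_orbit_rel \<C> k)" by (rule finite_quotient_power_orbit_rel) fact+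
  show "(\<lambda>x. x j) \<in> power_operations \<C> k" for j
  proof (rule power_operationsI)
    show "projection (Suc j) j \<in> nary \<C> (Suc j)" using \<C>(1) by (simp add: clone_def)
  qed (simp add: projection_def tuples_def del: upt_Suc)
  show "(\<lambda>x. \<phi> (\<lambda>j. \<psi> j x)) \<in> power_operations \<C> k"
    if "\<phi> \<in> power_operations \<C> k" "\<And>j. \<psi> j \<in> power_operations \<C> k" for \<phi> \<psi>
    by (rule power_operations_comp) fact+
  show "\<exists>n. \<forall>x y. (\<forall>j<n. x j = y j) \<longrightarrow> (\<phi> x, \<phi> y) \<in> power_orbit_rel \<C> k"
    if \<phi>: "\<phi> \<in> power_operations \<C> k" for \<phi>
  proof -
    obtain n f where f: "f \<in> nary \<C> n" "\<And>x i. i < k \<Longrightarrow> \<phi> x i = f (map (\<lambda>j. x j i) [0..<n])"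
      by (rule power_operationsE[OF \<phi>]) (rule that)
    show ?thesis
      by (intro exI[of _ n] allI impI power_orbit_relI[OF Gr_id[OF \<C>(1)]])
        (auto simp: f(2) intro!: arg_cong[of _ _ f])
  qed
  show "\<exists>\<phi>\<in>power_operations \<C> k. \<phi> (\<lambda>_. x) = y" if xy: "(x, y) \<in> power_orbit_rel \<C> k" for x y
  proof -
    obtain g where g: "g \<in> carrier (Gr \<C>)" "\<forall>i<k. y i = g (x i)"
      using xy by (auto simp: power_orbit_rel_def)
    show ?thesis
    proof
      \<comment> \<open>The value \<open>y i\<close> from \<open>k\<close> on makes the result equal
        to \<open>y\<close> in all entries.\<close>
      show "(\<lambda>z i. if i < k then g (z 0 i) else y i) \<in> power_operations \<C> k"
        by (rule power_operationsI[of "unary_op g" _ 1]) (use g in \<open>simp_all add: Gr_iff unary_op_def tuples_def\<close>)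
    qed (use g in auto)
  qed
  show "\<exists>\<psi>\<in>power_operations \<C> k. (\<forall>x\<in>B. \<psi> (\<lambda>_. x) = x) \<and>
      (\<forall>x. (\<phi> x, \<psi> x) \<in> power_orbit_rel \<C> k)"
    if "\<phi> \<in> power_operations \<C> k" "finite B" for \<phi> B
    by (rule power_operations_idempotent) fact+
qed

section \<open>The pseudo-loop condition on finitely many valuations\<close>

definition swap_indices :: "nat list" where
  "swap_indices = [3, 6, 9, 0, 7, 10, 1, 4, 11, 2, 5, 8]"

text \<open>\<open>swap_indices\<close> gives the position of each reversed pair; this makes the
  relation in the next lemma symmetric.\<close>

lemma swap_distinct_pairs_4:
  "map (\<lambda>j. map (\<lambda>r. s (fst r)) distinct_pairs_4 ! (swap_indices ! j)) [0..<12] = map (\<lambda>r. s (snd r)) distinct_pairs_4"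
  "map (\<lambda>j. map (\<lambda>r. s (snd r)) distinct_pairs_4 ! (swap_indices ! j)) [0..<12] = map (\<lambda>r. s (fst r)) distinct_pairs_4"
proof -
  have "length swap_indices = 12" by (simp add: swap_indices_def)
  then have eq: "map (\<lambda>j. xs ! (swap_indices ! j)) [0..<12] = map ((!) xs) swap_indices" for xs :: "'b list"
    by (intro nth_equalityI) simp_all
  show
    "map (\<lambda>j. map (\<lambda>r. s (fst r)) distinct_pairs_4 ! (swap_indices ! j)) [0..<12] = map (\<lambda>r. s (snd r)) distinct_pairs_4"
    "map (\<lambda>j. map (\<lambda>r. s (snd r)) distinct_pairs_4 ! (swap_indices ! j)) [0..<12] = map (\<lambda>r. s (fst r)) distinct_pairs_4"
    unfolding eq by (simp_all add: distinct_pairs_4_def swap_indices_def)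
qed

lemma local_pseudo_loop:
  fixes \<sigma> :: "nat \<Rightarrow> nat \<Rightarrow> 'a"
  assumes \<C>: "clone \<C>" "oligomorphic \<C>" "core \<C>" and taylor: "pseudo_taylor_term \<C> n t" and "k \<ge> 1"
  shows "\<exists>f\<in>nary \<C> 12. \<exists>g\<in>carrier (Gr \<C>). \<forall>i<k.
    f (map (\<lambda>r. \<sigma> i (snd r)) distinct_pairs_4) = g (f (map (\<lambda>r. \<sigma> i (fst r)) distinct_pairs_4))"
proof -
  interpret finite_orbit_clone "power_operations \<C> k" "power_orbit_rel \<C> k"
    by (rule finite_orbit_clone_power) fact+
  define x where "x i = map (\<lambda>r. \<sigma> i (fst r)) distinct_pairs_4" for i
  define y where "y i = map (\<lambda>r. \<sigma> i (snd r)) distinct_pairs_4" for i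
  have len: "length (x i) = 12" "length (y i) = 12" for i
    by (simp_all add: x_def y_def distinct_pairs_4_def)
  \<comment> \<open>The relation on the \<open>k\<close>-th power generated by the twelve edges of
    \<open>K_4\<close>, read as pairs of columns of valuations. A pair of \<open>R\<close> inside an
    orbit is a solution for the given valuations.\<close>
  define R where "R = {(p, q). \<exists>f\<in>nary \<C> 12. \<forall>i<k. p i = f (x i) \<and> q i = f (y i)}"
  have "sym R"
  proof (rule symI)
    fix p q assume "(p, q) \<in> R"
    then obtain f where f: "f \<in> nary \<C> 12" "\<forall>i<k. p i = f (x i) \<and> q i = f (y i)"
      by (auto simp: R_def)
    have "swap_indices ! j < 12" if "j < 12" for j
      using that nth_mem[of j swap_indices] by (force simp: swap_indices_def)
    then obtain h where h: "h \<in> nary \<C> 12"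
      "\<And>xs. length xs = 12 \<Longrightarrow> h xs = f (map (\<lambda>j. xs ! (swap_indices ! j)) [0..<12])"
      using nary_reindex[OF \<C>(1) f(1), of "\<lambda>j. swap_indices ! j" 12] by blast
    have "h (x i) = f (y i)" "h (y i) = f (x i)" for i
      by (simp_all only: h(2) len) (simp_all only: x_def y_def swap_distinct_pairs_4)
    with f(2) h(1) show "(q, p) \<in> R"
      unfolding R_def by (intro CollectI case_prodI bexI[of _ h]) simp_all
  qed
  moreover have "invariant_rel R"
    unfolding invariant_rel_def
  proof (intro ballI allI impI)
    fix \<phi> and p q :: "nat \<Rightarrow> nat \<Rightarrow> 'a" assume \<phi>: "\<phi> \<in> power_operations \<C> k" and "\<forall>j. (p j, q j) \<in> R"
    then have "\<forall>j. \<exists>f. f \<in> nary \<C> 12 \<and> (\<forall>i<k. p j i = f (x i) \<and> q j i = f (y i))"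
      by (auto simp: R_def)
    from choice[OF this] obtain f where f: "\<And>j. f j \<in> nary \<C> 12"
      "\<And>j i. i < k \<Longrightarrow> p j i = f j (x i)" "\<And>j i. i < k \<Longrightarrow> q j i = f j (y i)"
      by auto
    obtain m h where h: "h \<in> nary \<C> m" "\<And>z i. i < k \<Longrightarrow> \<phi> z i = h (map (\<lambda>j. z j i) [0..<m])"
      by (rule power_operationsE[OF \<phi>]) (rule that)
    obtain H where "H \<in> nary \<C> 12" "\<And>xs. length xs = 12 \<Longrightarrow> H xs = h (map (\<lambda>j. f j xs) [0..<m])"
      using nary_compose[OF \<C>(1) h(1), of f 12] f(1) by blast
    then show "(\<phi> p, \<phi> q) \<in> R"
      unfolding R_def by (auto intro!: bexI[of _ H] simp: h(2) f(2,3) len)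
  qed
  moreover have "triangle_vertices R \<noteq> {}"
  proof -
    have edge: "(\<lambda>i. x i ! m, \<lambda>i. y i ! m) \<in> R" if "m < 12" for m
    proof -
      have "projection 12 m \<in> nary \<C> 12" using \<C>(1) that by (simp add: clone_def)
      then show ?thesis
        unfolding R_def by (auto intro!: bexI[of _ "projection 12 m"] simp: projection_def tuples_def len)
    qed
    \<comment> \<open>Positions 0, 4 and 6 hold the pairs (1,2), (2,3) and (3,1).\<close>
    have "(\<lambda>i. \<sigma> i 1, \<lambda>i. \<sigma> i 2) \<in> R" "(\<lambda>i. \<sigma> i 2, \<lambda>i. \<sigma> i 3) \<in> R" "(\<lambda>i. \<sigma> i 3, \<lambda>i. \<sigma> i 1) \<in> R"
      using edge[of 0] edge[of 4] edge[of 6] by (simp_all add: x_def y_def distinct_pairs_4_def)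
    then show ?thesis unfolding triangle_vertices_def by blast
  qed
  moreover define \<tau> where "\<tau> z = (\<lambda>i. t (map (\<lambda>j. z j i) [0..<n]))" for z :: "nat \<Rightarrow> nat \<Rightarrow> 'a"
  obtain u v a b where t: "t \<in> nary \<C> n"
    and uv: "\<And>i. i < n \<Longrightarrow> u i \<in> nary \<C> 1" "\<And>i. i < n \<Longrightarrow> v i \<in> nary \<C> 1"
    and diag: "\<And>i. i < n \<Longrightarrow> a i i = X" "\<And>i. i < n \<Longrightarrow> b i i = Y"
    and eq: "\<And>i s. i < n \<Longrightarrow>
      u i [t (map (\<lambda>j. s (a i j)) [0..<n])] = v i [t (map (\<lambda>j. s (b i j)) [0..<n])]"
    using taylor unfolding pseudo_taylor_term_def by blast
  have "\<tau> \<in> power_operations \<C> k"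
    by (rule power_operationsI[OF t]) (simp add: \<tau>_def)
  moreover have "(\<tau> p, \<tau> q) \<in> power_orbit_rel \<C> k" if "\<And>j. j < n \<Longrightarrow> p j = q j" for p q
    using that by (intro power_orbit_relI[OF Gr_id[OF \<C>(1)]]) (auto simp: \<tau>_def intro!: arg_cong[of _ _ t])
  moreover have "(\<tau> (\<lambda>j. if a i j = X then p else q), \<tau> (\<lambda>j. if b i j = X then p else q)) \<in> power_orbit_rel \<C> k"
    if "i < n" for i p q
  proof -
    let ?p = "\<tau> (\<lambda>j. if a i j = X then p else q)" and ?q = "\<tau> (\<lambda>j. if b i j = X then p else q)"
    have uv_eq: "u i [?p l] = v i [?q l]" for l
    proof -
      define s where "s c = (if c = X then p l else q l)" for c
      have "?p l = t (map (\<lambda>j. s (a i j)) [0..<n])" "?q l = t (map (\<lambda>j. s (b i j)) [0..<n])"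
        unfolding \<tau>_def by (auto simp: s_def intro!: arg_cong[of _ _ t])
      then show ?thesis using eq[OF \<open>i < n\<close>, of s] by simp
    qed
    \<comment> \<open>On the finitely many values involved, density replaces \<open>u i\<close> and
      \<open>v i\<close> by group elements, so that the outer functions can be cancelled.\<close>
    obtain g where g: "g \<in> carrier (Gr \<C>)" "\<forall>d\<in>?p ` {..<k}. u i [d] = g d"
      using core_dense[OF \<C>(1,3) uv(1)[OF \<open>i < n\<close>], of "?p ` {..<k}"] by auto
    obtain h where h: "h \<in> carrier (Gr \<C>)" "\<forall>d\<in>?q ` {..<k}. v i [d] = h d"
      using core_dense[OF \<C>(1,3) uv(2)[OF \<open>i < n\<close>], of "?q ` {..<k}"] by auto
    show ?thesis
    proof (rule power_orbit_relI)
      show "inv_into UNIV h \<circ> g \<in> carrier (Gr \<C>)"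
        by (intro Gr_comp Gr_inv \<C> g h)
      fix l assume "l < k"
      then have "g (?p l) = h (?q l)" using g(2) h(2) uv_eq[of l] by auto
      then show "?q l = (inv_into UNIV h \<circ> g) (?p l)"
        by (simp add: Gr_inv_apply[OF h(1)])
    qed
  qed
  ultimately have "R \<inter> power_orbit_rel \<C> k \<noteq> {}"
    using diag by (intro loop_modulo_orbits[of R \<tau> n "\<lambda>i j. a i j = X" "\<lambda>i j. b i j = X"]) auto
  then obtain p q f g where "f \<in> nary \<C> 12" "g \<in> carrier (Gr \<C>)"
    and "\<forall>i<k. p i = f (x i) \<and> q i = f (y i)" "\<forall>i<k. q i = g (p i)"
    by (auto simp: R_def power_orbit_rel_def)
  then show ?thesis
    unfolding x_def y_def by (intro bexI[of _ f] bexI[of _ g]) auto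
qed

section \<open>Compactness\<close>

lemma orbit_limit_countable:
  fixes \<phi> :: "nat \<Rightarrow> 'c \<Rightarrow> 'a" and C :: "'c set"
  assumes \<C>: "clone \<C>" "oligomorphic \<C>" and C: "countable C"
  shows "\<exists>\<psi>. \<forall>N S. finite S \<and> S \<subseteq> C \<longrightarrow>
    (\<exists>j\<ge>N. \<exists>g\<in>carrier (Gr \<C>). \<forall>s\<in>S. \<psi> s = g (\<phi> j s))"
proof -
  obtain \<psi> where \<psi>: "\<And>N. \<exists>j\<ge>N. \<exists>g\<in>carrier (Gr \<C>). \<forall>i<N. \<psi> i = g (\<phi> j (from_nat_into C i))"
    using orbit_limit[OF \<C>, of "\<lambda>j i. \<phi> j (from_nat_into C i)"] by blast
  show ?thesis
  proof (intro exI[of _ "\<psi> \<circ> to_nat_on C"] allI impI)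
    fix N S assume S: "finite S \<and> S \<subseteq> C"
    then obtain M where M: "to_nat_on C ` S \<subseteq> {..<M}"
      using finite_nat_iff_bounded[of "to_nat_on C ` S"] by auto
    obtain j g where j: "j \<ge> max N M" and g: "g \<in> carrier (Gr \<C>)"
      "\<And>i. i < max N M \<Longrightarrow> \<psi> i = g (\<phi> j (from_nat_into C i))"
      using \<psi>[of "max N M"] by blast
    have "(\<psi> \<circ> to_nat_on C) s = g (\<phi> j s)" if "s \<in> S" for s
      using g(2)[of "to_nat_on C s"] that S M C by (auto simp: image_subset_iff subset_iff)
    with j g(1) show "\<exists>j\<ge>N. \<exists>g\<in>carrier (Gr \<C>). \<forall>s\<in>S. (\<psi> \<circ> to_nat_on C) s = g (\<phi> j s)"
      by (intro exI[of _ j]) auto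
  qed
qed

lemma countable_tuples: "countable (UNIV :: 'a set) \<Longrightarrow> countable (tuples n :: 'a list set)"
  using countable_lists[of "UNIV :: 'a set"] by (rule countable_subset[rotated]) auto

text \<open>
  Both the operation and the outer unary functions are limits of local solutions, after
  each of these has been multiplied by a suitable element of the group.
\<close>

lemma pL24_compactness:
  fixes \<C> :: "'a operations"
  assumes countable: "countable (UNIV :: 'a set)"
    and \<C>: "clone \<C>" "oligomorphic \<C>" and closed: "closed_operations \<C>"
    and local_solution: "\<And>(\<sigma> :: nat \<Rightarrow> nat \<Rightarrow> 'a) k. k \<ge> 1 \<Longrightarrow>
      \<exists>f\<in>nary \<C> 12. \<exists>g\<in>carrier (Gr \<C>). \<forall>i<k.
        f (map (\<lambda>r. \<sigma> i (snd r)) distinct_pairs_4) = g (f (map (\<lambda>r. \<sigma> i (fst r)) distinct_pairs_4))"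
  shows "satisfies_pL24 \<C>"
proof -
  let ?G = "carrier (Gr \<C>)"
  \<comment> \<open>Valuations are enumerated as lists of length 5, so that the variables 1 to 4
    serve as indices.\<close>
  have "tuples 5 \<noteq> ({} :: 'a list set)"
    by (auto simp: tuples_def intro: exI[of _ "replicate 5 undefined"])
  then obtain v :: "nat \<Rightarrow> 'a list" where v: "range v = tuples 5"
    using range_from_nat_into[OF _ countable_tuples[OF countable]] by blast
  define x where "x i = map (\<lambda>r. v i ! fst r) distinct_pairs_4" for i
  define y where "y i = map (\<lambda>r. v i ! snd r) distinct_pairs_4" for i
  have xy: "x i \<in> tuples 12" "y i \<in> tuples 12" for i
    by (simp_all add: x_def y_def tuples_def distinct_pairs_4_def)
  have "\<forall>k. \<exists>f. f \<in> nary \<C> 12 \<and> (\<exists>g\<in>?G. \<forall>i<Suc k. f (y i) = g (f (x i)))"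
    using local_solution[of "Suc _" "\<lambda>i. (!) (v i)"] unfolding x_def y_def by (simp add: Bex_def)
  from choice[OF this] obtain F where F: "\<And>k. F k \<in> nary \<C> 12"
    "\<And>k. \<exists>g\<in>?G. \<forall>i<Suc k. F k (y i) = g (F k (x i))"
    by blast
  from orbit_limit_countable[OF \<C> countable_tuples[OF countable], of 12 F]
  obtain \<psi> where \<psi>: "\<forall>N S. finite S \<and> S \<subseteq> tuples 12 \<longrightarrow>
      (\<exists>j\<ge>N. \<exists>g\<in>?G. \<forall>xs\<in>S. \<psi> xs = g (F j xs))" ..
  define f where "f = restrict \<psi> (tuples 12)"
  have f_eq: "f xs = \<psi> xs" if "xs \<in> tuples 12" for xs
    using that by (simp add: f_def)
  have f: "f \<in> nary \<C> 12"
  proof (rule closed_operations_limit[OF closed])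
    show "f \<in> tuples 12 \<rightarrow>\<^sub>E UNIV" by (simp add: f_def)
    fix D :: "'a list set" assume D: "finite D" "D \<subseteq> tuples 12"
    obtain j g where g: "g \<in> ?G" "\<forall>xs\<in>D. \<psi> xs = g (F j xs)" using \<psi> D by blast
    obtain h where "h \<in> nary \<C> 12" "\<forall>xs. length xs = 12 \<longrightarrow> h xs = g (F j xs)"
      using Gr_nary_compose[OF \<C>(1) g(1) F(1)] by blast
    then show "\<exists>h\<in>nary \<C> 12. \<forall>xs\<in>D. h xs = f xs"
      using D(2) g(2) by (intro bexI[of _ h]) (auto simp: f_eq tuples_def subset_iff)
  qed simp
  have "\<exists>h. h \<in> ?G \<and> (\<forall>i<k. f (y i) = h (f (x i)))" for k
  proof -
    have "finite (x ` {..<k} \<union> y ` {..<k}) \<and> x ` {..<k} \<union> y ` {..<k} \<subseteq> tuples 12"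
      using xy by auto
    from \<psi>[rule_format, OF this, of k] obtain j g where j: "j \<ge> k" and "g \<in> ?G"
      and "\<forall>xs\<in>x ` {..<k} \<union> y ` {..<k}. \<psi> xs = g (F j xs)"
      by blast
    then have g: "g \<in> ?G"
      "\<And>i. i < k \<Longrightarrow> f (x i) = g (F j (x i))" "\<And>i. i < k \<Longrightarrow> f (y i) = g (F j (y i))"
      using xy by (auto simp: f_eq)
    obtain h where h: "h \<in> ?G" "\<forall>i<Suc j. F j (y i) = h (F j (x i))" using F(2) by blast
    show ?thesis
    \<comment> \<open>On these tuples \<open>f\<close> is \<open>F j\<close> followed by
      \<open>g\<close>, so the group element \<open>h\<close> for \<open>F j\<close> has to be
      conjugated by \<open>g\<close>.\<close>
    proof (intro exI[of _ "g \<circ> (h \<circ> inv_into UNIV g)"] conjI allI impI)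
      show "g \<circ> (h \<circ> inv_into UNIV g) \<in> ?G"
        by (intro Gr_comp Gr_inv \<C>(1) g(1) h(1))
      show "f (y i) = (g \<circ> (h \<circ> inv_into UNIV g)) (f (x i))" if "i < k" for i
        using that g h(2) j by (simp add: Gr_inv_apply[OF g(1)])
    qed
  qed
  then have "\<forall>k. \<exists>h. h \<in> ?G \<and> (\<forall>i<k. f (y i) = h (f (x i)))" ..
  from choice[OF this] obtain H where H: "\<And>k. H k \<in> ?G" "\<And>k i. i < k \<Longrightarrow> f (y i) = H k (f (x i))"
    by blast
  \<comment> \<open>The maps \<open>H j\<close> and the identity are passed to the limit together:
    the tag \<open>True\<close> or \<open>False\<close> tells them apart, and the same
    \<open>g\<close> corrects both. This common factor is what makes \<open>u1\<close> and
    \<open>u2\<close> agree in the end.\<close>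
  have "countable (UNIV \<times> UNIV :: ('a \<times> bool) set)"
    by (intro countable_SIGMA countable) simp
  from orbit_limit_countable[OF \<C> this, of "\<lambda>j (z, b). if b then H j z else z"]
  obtain \<theta> where \<theta>: "\<forall>N S. finite S \<and> S \<subseteq> UNIV \<times> UNIV \<longrightarrow>
      (\<exists>j\<ge>N. \<exists>g\<in>?G. \<forall>s\<in>S. \<theta> s = g (case s of (z, b) \<Rightarrow> if b then H j z else z))" ..
  have limit: "\<exists>j\<ge>N. \<exists>g\<in>?G. \<forall>z\<in>S. \<theta> (z, True) = g (H j z) \<and> \<theta> (z, False) = g z"
    if "finite S" for N S
  proof -
    have "finite (S \<times> (UNIV :: bool set)) \<and> S \<times> UNIV \<subseteq> UNIV \<times> UNIV" using that by auto
    from \<theta>[rule_format, OF this, of N] obtain j g where "j \<ge> N" "g \<in> ?G"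
      and "\<forall>s\<in>S \<times> UNIV. \<theta> s = g (case s of (z, b) \<Rightarrow> if b then H j z else z)"
      by blast
    then show ?thesis by auto
  qed
  have unary: "unary_op u \<in> nary \<C> 1"
    if u: "\<And>S. finite S \<Longrightarrow> \<exists>g\<in>?G. \<forall>z\<in>S. u z = g z" for u
  proof (rule closed_operations_limit[OF closed])
    show "unary_op u \<in> tuples 1 \<rightarrow>\<^sub>E UNIV" by (simp add: unary_op_def)
    fix D :: "'a list set" assume D: "finite D" "D \<subseteq> tuples 1"
    then obtain g where "g \<in> ?G" "\<forall>z\<in>hd ` D. u z = g z" using u[of "hd ` D"] by auto
    then show "\<exists>h\<in>nary \<C> 1. \<forall>xs\<in>D. h xs = unary_op u xs"
      using D(2) by (intro bexI[of _ "unary_op g"]) (auto simp: Gr_iff unary_op_def)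
  qed simp
  define u1 where "u1 = unary_op (\<lambda>z. \<theta> (z, True))"
  define u2 where "u2 = unary_op (\<lambda>z. \<theta> (z, False))"
  have "u1 \<in> nary \<C> 1"
    unfolding u1_def
  proof (rule unary)
    fix S :: "'a set" assume "finite S"
    then obtain j g where "g \<in> ?G" "\<forall>z\<in>S. \<theta> (z, True) = g (H j z)"
      using limit[of S 0] by auto
    then show "\<exists>g\<in>?G. \<forall>z\<in>S. \<theta> (z, True) = g z"
      by (intro bexI[of _ "g \<circ> H j"] Gr_comp \<C>(1) H(1)) auto
  qed
  moreover have "u2 \<in> nary \<C> 1"
    unfolding u2_def
  proof (rule unary)
    show "\<exists>g\<in>?G. \<forall>z\<in>S. \<theta> (z, False) = g z" if "finite S" for S
      using limit[OF that, of 0] by auto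
  qed
  moreover have "u1 [f (map (\<lambda>r. \<sigma> (fst r)) distinct_pairs_4)] = u2 [f (map (\<lambda>r. \<sigma> (snd r)) distinct_pairs_4)]"
    for \<sigma> :: "nat \<Rightarrow> 'a"
  proof -
    have "map \<sigma> [0..<5] \<in> range v" by (simp add: v tuples_def)
    then obtain i where i: "map \<sigma> [0..<5] = v i" by auto
    have "v i ! m = \<sigma> m" if "m < 5" for m
      using that by (simp add: i[symmetric])
    then have "map (\<lambda>r. \<sigma> (fst r)) distinct_pairs_4 = x i" "map (\<lambda>r. \<sigma> (snd r)) distinct_pairs_4 = y i"
      by (simp_all add: x_def y_def distinct_pairs_4_def)
    \<comment> \<open>The bound \<open>Suc i\<close> ensures \<open>i < j\<close>, so that
      \<open>H j\<close> solves the \<open>i\<close>-th valuation.\<close>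
    moreover obtain j g where "j \<ge> Suc i" "\<theta> (f (x i), True) = g (H j (f (x i)))" "\<theta> (f (y i), False) = g (f (y i))"
      using limit[of "{f (x i), f (y i)}" "Suc i"] by auto
    ultimately show ?thesis
      using H(2)[of i j] by (simp add: u1_def u2_def unary_op_def tuples_def)
  qed
  ultimately show ?thesis
    using f unfolding satisfies_pL24_def by blast
qed

theorem theorem4p7:
  fixes \<C> :: "'a operations"
  assumes "countable (UNIV :: 'a set)"
    and "clone \<C>"
    and "closed_operations \<C>"
    and "oligomorphic \<C>"
    and "core \<C>"
    and "\<exists>n t. pseudo_taylor_term \<C> n t"
  shows "satisfies_pL24 \<C>"
proof -
  obtain n t where "pseudo_taylor_term \<C> n t" using assms(6) by blast
  then show ?thesis
    using local_pseudo_loop[OF assms(2,4,5)] assms by (intro pL24_compactness) blast+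
qed

end
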